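(* Let $\mathbb G$ be an affine group scheme of finite type over $k$ and let $\mathcal M$ be a family of $\mathbb G$-modules. Let $X \subset \mathcal O(\mathbb G)$ be the smallest subspace such that $M \in Mod(\mathbb G,X)$ for all $M \in \mathcal M$. Then $\mathcal O(\mathbb G)_{\langle X \rangle}$ is the smallest subcoalgebra $C \subset \mathcal O(\mathbb G)$ with the property that $Mod(\mathbb G,X) \subset CoMod(C)$ as subcategories of $Mod(\mathbb G)$. In particular, $Mod(\mathbb G,\mathcal O(\mathbb G)_{\langle X \rangle}) = CoMod(\mathcal O(\mathbb G)_{\langle X \rangle})$.
   Context: $k$ is a field of characteristic $p>0$ and $\mathcal O(\mathbb G)$ is the coordinate algebra of $\mathbb G$. $Mod(\mathbb G)$ is the abelian category of $\mathbb G$-modules, i.e. (possibly infinite dimensional) right $\mathcal O(\mathbb G)$-comodules $M$ with coaction $\Delta_M: M \to M\otimes \mathcal O(\mathbb G)$. For a $k$-subspace $X \subset \mathcal O(\mathbb G)$, $Mod(\mathbb G,X)$ is the full subcategory of $Mod(\mathbb G)$ whose objects are the $\mathbb G$-modules $M$ whose coaction factors through $M\otimes X \subset M \otimes \mathcal O(\mathbb G)$. $\mathcal O(\mathbb G)_{\langle X\rangle}$ denotes the smallest subcoalgebra of $\mathcal O(\mathbb G)$ containing $X$. For a subcoalgebra $C\subset\mathcal O(\mathbb G)$, $CoMod(C)$ is the category of right $C$-comodules, viewed as a subcategory of $Mod(\mathbb G)$ via the inclusion $C\subset\mathcal O(\mathbb G)$. *)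

theory Defs
  imports "HOL-Algebra.Module" "HOL-Algebra.AbelCoset" "HOL-Algebra.Generated_Rings"
begin

text \<open>
  Vector spaces over a field \<open>k\<close> are modules over \<open>k\<close> in the sense of HOL-Algebra. Their records
  extend \<^typ>\<open>'a ring\<close>, so they carry fields \<open>mult\<close> and \<open>one\<close> which have no meaning unless the
  space is an algebra.
\<close>

section \<open>Linear maps and tensor products\<close>

definition linear_maps ::
    "('k, 'r) ring_scheme \<Rightarrow> ('k, 'm, 'x) module_scheme \<Rightarrow> ('k, 'n, 'y) module_scheme \<Rightarrow> ('m \<Rightarrow> 'n) set"
  where "linear_maps k M N = {f. f \<in> carrier M \<rightarrow> carrier N
    \<and> (\<forall>x\<in>carrier M. \<forall>y\<in>carrier M. f (x \<oplus>\<^bsub>M\<^esub> y) = f x \<oplus>\<^bsub>N\<^esub> f y)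
    \<and> (\<forall>c\<in>carrier k. \<forall>x\<in>carrier M. f (c \<odot>\<^bsub>M\<^esub> x) = c \<odot>\<^bsub>N\<^esub> f x)}"

definition self_module :: "('k, 'r) ring_scheme \<Rightarrow> ('k, 'k) module"
  where "self_module k = \<lparr>carrier = carrier k, monoid.mult = monoid.mult k, one = one k,
    ring.zero = ring.zero k, ring.add = ring.add k, smult = monoid.mult k\<rparr>"

definition free_module :: "('k, 'r) ring_scheme \<Rightarrow> 's set \<Rightarrow> ('k, 's \<Rightarrow> 'k) module"
  where "free_module k S = \<lparr>
    carrier = {f. (\<forall>s\<in>S. f s \<in> carrier k) \<and> (\<forall>s. s \<notin> S \<longrightarrow> f s = \<zero>\<^bsub>k\<^esub>) \<and> finite {s. f s \<noteq> \<zero>\<^bsub>k\<^esub>}},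
    monoid.mult = undefined, one = undefined,
    ring.zero = (\<lambda>s. \<zero>\<^bsub>k\<^esub>), ring.add = (\<lambda>f g s. f s \<oplus>\<^bsub>k\<^esub> g s),
    smult = (\<lambda>c f s. c \<otimes>\<^bsub>k\<^esub> f s)\<rparr>"

definition basis_vector :: "('k, 'r) ring_scheme \<Rightarrow> 's \<Rightarrow> 's \<Rightarrow> 'k"
  where "basis_vector k s = (\<lambda>t. if t = s then \<one>\<^bsub>k\<^esub> else \<zero>\<^bsub>k\<^esub>)"

definition quotient_module ::
    "('k, 'r) ring_scheme \<Rightarrow> ('k, 'm, 'x) module_scheme \<Rightarrow> 'm set \<Rightarrow> ('k, 'm set) module"
  where "quotient_module k M K = \<lparr>
    carrier = a_rcosets\<^bsub>M\<^esub> K, monoid.mult = undefined, one = undefined,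
    ring.zero = K, ring.add = set_add M,
    smult = (\<lambda>c T. \<Union>x\<in>T. K +>\<^bsub>M\<^esub> (c \<odot>\<^bsub>M\<^esub> x))\<rparr>"

definition generated_submodule ::
    "('k, 'r) ring_scheme \<Rightarrow> ('k, 'm, 'x) module_scheme \<Rightarrow> 'm set \<Rightarrow> 'm set"
  where "generated_submodule k M S = \<Inter>{K. submodule K k M \<and> S \<subseteq> K}"

definition bilinear_relations ::
    "('k, 'r) ring_scheme \<Rightarrow> ('k, 'm, 'x) module_scheme \<Rightarrow> ('k, 'n, 'y) module_scheme \<Rightarrow> ('m \<times> 'n \<Rightarrow> 'k) set"
  where "bilinear_relations k M N =
    (let F = free_module k (carrier M \<times> carrier N); e = basis_vector k in
      {e (x \<oplus>\<^bsub>M\<^esub> x', y) \<ominus>\<^bsub>F\<^esub> (e (x, y) \<oplus>\<^bsub>F\<^esub> e (x', y)) | x x' y.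
         x \<in> carrier M \<and> x' \<in> carrier M \<and> y \<in> carrier N}
    \<union> {e (x, y \<oplus>\<^bsub>N\<^esub> y') \<ominus>\<^bsub>F\<^esub> (e (x, y) \<oplus>\<^bsub>F\<^esub> e (x, y')) | x y y'.
         x \<in> carrier M \<and> y \<in> carrier N \<and> y' \<in> carrier N}
    \<union> {e (c \<odot>\<^bsub>M\<^esub> x, y) \<ominus>\<^bsub>F\<^esub> c \<odot>\<^bsub>F\<^esub> e (x, y) | c x y.
         c \<in> carrier k \<and> x \<in> carrier M \<and> y \<in> carrier N}
    \<union> {e (x, c \<odot>\<^bsub>N\<^esub> y) \<ominus>\<^bsub>F\<^esub> c \<odot>\<^bsub>F\<^esub> e (x, y) | c x y.
         c \<in> carrier k \<and> x \<in> carrier M \<and> y \<in> carrier N})"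

type_synonym ('k, 'm, 'n) tensor = "('m \<times> 'n \<Rightarrow> 'k) set"

definition tensor_kernel ::
    "('k, 'r) ring_scheme \<Rightarrow> ('k, 'm, 'x) module_scheme \<Rightarrow> ('k, 'n, 'y) module_scheme \<Rightarrow> ('m \<times> 'n \<Rightarrow> 'k) set"
  where "tensor_kernel k M N =
    generated_submodule k (free_module k (carrier M \<times> carrier N)) (bilinear_relations k M N)"

definition tensor_product ::
    "('k, 'r) ring_scheme \<Rightarrow> ('k, 'm, 'x) module_scheme \<Rightarrow> ('k, 'n, 'y) module_scheme
      \<Rightarrow> ('k, ('k, 'm, 'n) tensor) module"
  where "tensor_product k M N =
    quotient_module k (free_module k (carrier M \<times> carrier N)) (tensor_kernel k M N)"

definition pure_tensor ::
    "('k, 'r) ring_scheme \<Rightarrow> ('k, 'm, 'x) module_scheme \<Rightarrow> ('k, 'n, 'y) module_scheme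
      \<Rightarrow> 'm \<Rightarrow> 'n \<Rightarrow> ('k, 'm, 'n) tensor"
  where "pure_tensor k M N x y =
    tensor_kernel k M N +>\<^bsub>free_module k (carrier M \<times> carrier N)\<^esub> basis_vector k (x, y)"

text \<open>
  The linear map from a tensor product to \<open>P\<close> induced by a bilinear map \<open>b\<close>, evaluated on an
  arbitrary representative of the coset \<open>t\<close>; it is only used for bilinear \<open>b\<close>, where the choice of
  the representative is irrelevant.
\<close>
definition tensor_lift ::
    "('k, 'r) ring_scheme \<Rightarrow> ('k, 'p, 'x) module_scheme \<Rightarrow> ('m \<Rightarrow> 'n \<Rightarrow> 'p) \<Rightarrow> ('k, 'm, 'n) tensor \<Rightarrow> 'p"
  where "tensor_lift k P b t =
    (let \<phi> = (SOME \<phi>. \<phi> \<in> t)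
     in finsum P (\<lambda>(x, y). \<phi> (x, y) \<odot>\<^bsub>P\<^esub> b x y) {s. \<phi> s \<noteq> \<zero>\<^bsub>k\<^esub>})"

text \<open>The map \<open>f \<otimes> g\<close>; here \<open>M\<close> and \<open>N\<close> are the codomains of \<open>f\<close> and \<open>g\<close>.\<close>
definition tensor_map ::
    "('k, 'r) ring_scheme \<Rightarrow> ('k, 'm, 'x) module_scheme \<Rightarrow> ('k, 'n, 'y) module_scheme
      \<Rightarrow> ('u \<Rightarrow> 'm) \<Rightarrow> ('v \<Rightarrow> 'n) \<Rightarrow> ('k, 'u, 'v) tensor \<Rightarrow> ('k, 'm, 'n) tensor"
  where "tensor_map k M N f g =
    tensor_lift k (tensor_product k M N) (\<lambda>u v. pure_tensor k M N (f u) (g v))"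

text \<open>The isomorphism from \<open>(L \<otimes> M) \<otimes> N\<close> to \<open>L \<otimes> (M \<otimes> N)\<close>.\<close>
definition tensor_assoc ::
    "('k, 'r) ring_scheme \<Rightarrow> ('k, 'l, 'x) module_scheme \<Rightarrow> ('k, 'm, 'y) module_scheme
      \<Rightarrow> ('k, 'n, 'z) module_scheme
      \<Rightarrow> ('k, ('k, 'l, 'm) tensor, 'n) tensor \<Rightarrow> ('k, 'l, ('k, 'm, 'n) tensor) tensor"
  where "tensor_assoc k L M N =
    (let P = tensor_product k L (tensor_product k M N)
     in tensor_lift k P (\<lambda>t z. tensor_lift k P
          (\<lambda>x y. pure_tensor k L (tensor_product k M N) x (pure_tensor k M N y z)) t))"

text \<open>
  The image of \<open>U \<otimes> V\<close> in \<open>M \<otimes> N\<close> for subspaces \<open>U\<close> of \<open>M\<close> and \<open>V\<close> of \<open>N\<close>.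
  Over a field it is isomorphic to \<open>U \<otimes> V\<close>.
\<close>
definition sub_tensor ::
    "('k, 'r) ring_scheme \<Rightarrow> ('k, 'm, 'x) module_scheme \<Rightarrow> ('k, 'n, 'y) module_scheme
      \<Rightarrow> 'm set \<Rightarrow> 'n set \<Rightarrow> ('k, 'm, 'n) tensor set"
  where "sub_tensor k M N U V =
    tensor_map k M N id id ` carrier (tensor_product k (M\<lparr>carrier := U\<rparr>) (N\<lparr>carrier := V\<rparr>))"

definition tensor_algebra ::
    "('k, 'r) ring_scheme \<Rightarrow> ('k, 'a, 'x) module_scheme \<Rightarrow> ('k, 'b, 'y) module_scheme
      \<Rightarrow> ('k, ('k, 'a, 'b) tensor) module"
  where "tensor_algebra k A B =
    (let P = tensor_product k A B in P\<lparr>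
      monoid.mult := (\<lambda>s t. tensor_lift k P (\<lambda>a b. tensor_lift k P
        (\<lambda>a' b'. pure_tensor k A B (a \<otimes>\<^bsub>A\<^esub> a') (b \<otimes>\<^bsub>B\<^esub> b')) t) s),
      one := pure_tensor k A B \<one>\<^bsub>A\<^esub> \<one>\<^bsub>B\<^esub>\<rparr>)"


section \<open>Coalgebras and comodules\<close>

record ('k, 'a) coalgebra = "('k, 'a) module" +
  comult :: "'a \<Rightarrow> ('a \<times> 'a \<Rightarrow> 'k) set"
  counit :: "'a \<Rightarrow> 'k"

locale coalgebra = module k C
  for k :: "('k, 'r) ring_scheme" (structure) and C :: "('k, 'a, 'x) coalgebra_scheme" (structure) +
  assumes comult_linear: "comult C \<in> linear_maps k C (tensor_product k C C)"
    and counit_linear: "counit C \<in> linear_maps k C (self_module k)"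
    and coassociative: "c \<in> carrier C \<Longrightarrow>
      tensor_assoc k C C C (tensor_map k (tensor_product k C C) C (comult C) id (comult C c))
      = tensor_map k C (tensor_product k C C) id (comult C) (comult C c)"
    and left_counital: "c \<in> carrier C \<Longrightarrow>
      tensor_lift k C (\<lambda>x y. counit C x \<odot>\<^bsub>C\<^esub> y) (comult C c) = c"
    and right_counital: "c \<in> carrier C \<Longrightarrow>
      tensor_lift k C (\<lambda>x y. counit C y \<odot>\<^bsub>C\<^esub> x) (comult C c) = c"

definition subcoalgebra :: "('k, 'r) ring_scheme \<Rightarrow> ('k, 'a, 'x) coalgebra_scheme \<Rightarrow> 'a set \<Rightarrow> bool"
  where "subcoalgebra k A C \<longleftrightarrow> submodule C k A \<and> comult A ` C \<subseteq> sub_tensor k A A C C"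

text \<open>
  A subcoalgebra as a coalgebra in its own right. Its comultiplication has to land in the tensor
  square of \<open>C\<close> itself; as \<open>k\<close> is a field, that square embeds into \<open>A \<otimes> A\<close>, so that the preimage
  chosen below is unique.
\<close>
definition restrict_coalgebra ::
    "('k, 'r) ring_scheme \<Rightarrow> ('k, 'a, 'x) coalgebra_scheme \<Rightarrow> 'a set \<Rightarrow> ('k, 'a, 'x) coalgebra_scheme"
  where "restrict_coalgebra k A C =
    (let C' = A\<lparr>carrier := C\<rparr>
     in C'\<lparr>comult := (\<lambda>c. THE t. t \<in> carrier (tensor_product k C' C')
                                 \<and> tensor_map k A A id id t = comult A c)\<rparr>)"

definition generated_subcoalgebra ::
    "('k, 'r) ring_scheme \<Rightarrow> ('k, 'a, 'x) coalgebra_scheme \<Rightarrow> 'a set \<Rightarrow> 'a set"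
  where "generated_subcoalgebra k A X = (LEAST C. subcoalgebra k A C \<and> X \<subseteq> C)"

record ('k, 'm, 'c) comodule = "('k, 'm) module" +
  coact :: "'m \<Rightarrow> ('m \<times> 'c \<Rightarrow> 'k) set"

text \<open>
  Coactions and morphisms are required to be extensional, so that two of them are equal as soon as
  they agree on the carrier.
\<close>
locale right_comodule = module k M
  for k :: "('k, 'r) ring_scheme" (structure) and C :: "('k, 'c, 'x) coalgebra_scheme" (structure)
    and M :: "('k, 'm, 'c) comodule" (structure) +
  assumes coact_linear: "coact M \<in> linear_maps k M (tensor_product k M C)"
    and coact_extensional: "coact M \<in> extensional (carrier M)"
    and coact_coassociative: "m \<in> carrier M \<Longrightarrow>
      tensor_assoc k M C C (tensor_map k (tensor_product k M C) C (coact M) id (coact M m))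
      = tensor_map k M (tensor_product k C C) id (comult C) (coact M m)"
    and coact_counital: "m \<in> carrier M \<Longrightarrow>
      tensor_lift k M (\<lambda>x c. counit C c \<odot>\<^bsub>M\<^esub> x) (coact M m) = m"

definition comodule_homs ::
    "('k, 'r) ring_scheme \<Rightarrow> ('k, 'c, 'x) coalgebra_scheme
      \<Rightarrow> ('k, 'm, 'c) comodule \<Rightarrow> ('k, 'm, 'c) comodule \<Rightarrow> ('m \<Rightarrow> 'm) set"
  where "comodule_homs k C M N = {f \<in> linear_maps k M N \<inter> extensional (carrier M).
    \<forall>m\<in>carrier M. tensor_map k N C f id (coact M m) = coact N (f m)}"


section \<open>Affine group schemes and their modules\<close>

record ('k, 'a) hopf_algebra = "('k, 'a) coalgebra" +
  antipode :: "'a \<Rightarrow> 'a"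

text \<open>
  An affine group scheme of finite type over \<open>k\<close> is given by its coordinate algebra \<open>G\<close>, a
  commutative Hopf algebra that is finitely generated as an algebra.
\<close>
locale affine_group_scheme_of_finite_type =
  field k + algebra k G + coalgebra k G
  for k :: "('k, 'r) ring_scheme" (structure) and G :: "('k, 'a, 'x) hopf_algebra_scheme" (structure) +
  assumes comult_hom: "comult G \<in> ring_hom G (tensor_algebra k G G)"
    and counit_hom: "counit G \<in> ring_hom G k"
    and antipode_linear: "antipode G \<in> linear_maps k G G"
    and antipode_left: "a \<in> carrier G \<Longrightarrow>
      tensor_lift k G (\<lambda>x y. antipode G x \<otimes>\<^bsub>G\<^esub> y) (comult G a) = counit G a \<odot>\<^bsub>G\<^esub> \<one>\<^bsub>G\<^esub>"
    and antipode_right: "a \<in> carrier G \<Longrightarrow>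
      tensor_lift k G (\<lambda>x y. x \<otimes>\<^bsub>G\<^esub> antipode G y) (comult G a) = counit G a \<odot>\<^bsub>G\<^esub> \<one>\<^bsub>G\<^esub>"
    and finite_type: "\<exists>S. finite S \<and> S \<subseteq> carrier G \<and>
      generate_ring G (S \<union> {c \<odot>\<^bsub>G\<^esub> \<one>\<^bsub>G\<^esub> | c. c \<in> carrier k}) = carrier G"

definition has_characteristic :: "('k, 'r) ring_scheme \<Rightarrow> nat \<Rightarrow> bool"
  where "has_characteristic k p \<longleftrightarrow> (\<forall>n::nat. [n] \<cdot>\<^bsub>k\<^esub> \<one>\<^bsub>k\<^esub> = \<zero>\<^bsub>k\<^esub> \<longleftrightarrow> p dvd n)"

text \<open>
  A category of comodules with underlying sets in \<open>'m\<close>. A morphism is recorded together with its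
  source and its target. The type \<open>'m\<close> serves as the universe of the modules under consideration.
\<close>
record ('k, 'm, 'a) comodule_category =
  objects :: "('k, 'm, 'a) comodule set"
  arrows :: "(('k, 'm, 'a) comodule \<times> ('m \<Rightarrow> 'm) \<times> ('k, 'm, 'a) comodule) set"

definition is_subcategory ::
    "('k, 'm, 'a) comodule_category \<Rightarrow> ('k, 'm, 'a) comodule_category \<Rightarrow> bool"
  where "is_subcategory \<C> \<D> \<longleftrightarrow> objects \<C> \<subseteq> objects \<D> \<and> arrows \<C> \<subseteq> arrows \<D>"

definition comodule_cat ::
    "('k, 'r) ring_scheme \<Rightarrow> ('k, 'c, 'x) coalgebra_scheme \<Rightarrow> ('k, 'm, 'c) comodule_category"
  where "comodule_cat k C = \<lparr>
    objects = {M. right_comodule k C M},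
    arrows = {(M, f, N). right_comodule k C M \<and> right_comodule k C N \<and> f \<in> comodule_homs k C M N}\<rparr>"

abbreviation group_modules ::
    "('k, 'r) ring_scheme \<Rightarrow> ('k, 'a, 'x) hopf_algebra_scheme \<Rightarrow> ('k, 'm, 'a) comodule_category"
  where "group_modules k G \<equiv> comodule_cat k G"

definition group_modules_in ::
    "('k, 'r) ring_scheme \<Rightarrow> ('k, 'a, 'x) hopf_algebra_scheme \<Rightarrow> 'a set
      \<Rightarrow> ('k, 'm, 'a) comodule_category"
  where "group_modules_in k G X =
    (let Obj = {M \<in> objects (group_modules k G). coact M ` carrier M \<subseteq> sub_tensor k M G (carrier M) X}
     in \<lparr>objects = Obj,
         arrows = {(M, f, N) \<in> arrows (group_modules k G). M \<in> Obj \<and> N \<in> Obj}\<rparr>)"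

text \<open>
  The functor from \<open>C\<close>-comodules to \<open>G\<close>-modules given by the inclusion of \<open>C\<close> into the coordinate
  algebra, and \<open>CoMod(C)\<close> as a subcategory of \<open>Mod(G)\<close>.
\<close>
definition extend_coaction ::
    "('k, 'r) ring_scheme \<Rightarrow> ('k, 'a, 'x) hopf_algebra_scheme \<Rightarrow> ('k, 'm, 'a) comodule
      \<Rightarrow> ('k, 'm, 'a) comodule"
  where "extend_coaction k G M =
    M\<lparr>coact := restrict (\<lambda>m. tensor_map k M G id id (coact M m)) (carrier M)\<rparr>"

definition CoMod ::
    "('k, 'r) ring_scheme \<Rightarrow> ('k, 'a, 'x) hopf_algebra_scheme \<Rightarrow> 'a set
      \<Rightarrow> ('k, 'm, 'a) comodule_category"
  where "CoMod k G C =
    (let \<D> = comodule_cat k (restrict_coalgebra k G C)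
     in \<lparr>objects = extend_coaction k G ` objects \<D>,
         arrows = (\<lambda>(M, f, N). (extend_coaction k G M, f, extend_coaction k G N)) ` arrows \<D>\<rparr>)"

end

theory Submission
  imports Defs
begin

text \<open>
  The result rests on two facts about tensor products over a field \<open>k\<close>.

  First, membership in \<open>U \<otimes> V \<subseteq> M \<otimes> N\<close> can be tested on slices. A functional \<open>f\<close> on \<open>M\<close> induces
  \<open>f \<otimes> id : M \<otimes> N \<rightarrow> N\<close>, and a tensor of \<open>U \<otimes> N\<close> all of whose slices lie in \<open>V\<close> belongs to \<open>U \<otimes> V\<close>
  (\<open>pure_sum_of_slices\<close>, \<open>mem_sub_tensor_of_slices\<close>). Indeed, if \<open>t = x\<^sub>1 \<otimes> y\<^sub>1 + \<dots> + x\<^sub>n \<otimes> y\<^sub>n\<close> and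
  \<open>x\<^sub>1\<close> is a combination of the other \<open>x\<^sub>i\<close>, then \<open>t\<close> is a sum of \<open>n - 1\<close> pure tensors; otherwise some
  functional is \<open>1\<close> on \<open>x\<^sub>1\<close> and \<open>0\<close> on the other \<open>x\<^sub>i\<close>, so that \<open>y\<^sub>1 \<in> V\<close>, and \<open>x\<^sub>1 \<otimes> y\<^sub>1\<close> can be split off.
  Induction on \<open>n\<close> finishes the argument, without a basis of \<open>M\<close>. A condition on slices is preserved
  by intersections. Hence an intersection of subcoalgebras is a subcoalgebra, and an intersection of
  subspaces \<open>Y\<close> with \<open>M \<in> Mod(G, Y)\<close> again has this property, so the least subcoalgebra containing a
  subset and the least subspace \<open>V\<close> for a family of modules exist.

  Second, a tensor product of injective linear maps is injective (\<open>tensor_map_inj_on\<close>): this is the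
  slice criterion for the subspace \<open>0\<close>. So for a subcoalgebra \<open>C\<close> the spaces \<open>M \<otimes> C\<close> and
  \<open>M \<otimes> (C \<otimes> C)\<close> embed into \<open>M \<otimes> G\<close> and \<open>M \<otimes> (G \<otimes> G)\<close>. A coaction with values in \<open>M \<otimes> C\<close> therefore
  lifts uniquely, and the comodule axioms and the condition on morphisms hold over \<open>C\<close> if and only
  if they hold over \<open>G\<close>. This gives \<open>Mod(G, C) = CoMod(C)\<close> for every subcoalgebra \<open>C\<close>
  (\<open>group_modules_in_subcoalgebra\<close>).

  The theorem follows formally. Let \<open>D\<close> be the subcoalgebra generated by \<open>V\<close>. Then
  \<open>Mod(G, V) \<subseteq> Mod(G, D) = CoMod(D)\<close>. Conversely, if \<open>Mod(G, V) \<subseteq> CoMod(C) = Mod(G, C)\<close> for a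
  subcoalgebra \<open>C\<close>, then the given family lies in \<open>Mod(G, C)\<close>, so \<open>V \<subseteq> C\<close> by minimality of \<open>V\<close> and
  \<open>D \<subseteq> C\<close> by minimality of \<open>D\<close>.
\<close>

section \<open>Linear maps and submodules\<close>

lemma linear_mapsI:
  assumes "\<And>x. x \<in> carrier M \<Longrightarrow> f x \<in> carrier N"
    and "\<And>x y. x \<in> carrier M \<Longrightarrow> y \<in> carrier M \<Longrightarrow> f (x \<oplus>\<^bsub>M\<^esub> y) = f x \<oplus>\<^bsub>N\<^esub> f y"
    and "\<And>c x. c \<in> carrier k \<Longrightarrow> x \<in> carrier M \<Longrightarrow> f (c \<odot>\<^bsub>M\<^esub> x) = c \<odot>\<^bsub>N\<^esub> f x"
  shows "f \<in> linear_maps k M N"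
  using assms by (auto simp: linear_maps_def)

lemma linear_mapsD:
  assumes "f \<in> linear_maps k M N"
  shows linear_maps_closed: "x \<in> carrier M \<Longrightarrow> f x \<in> carrier N"
    and linear_maps_add: "x \<in> carrier M \<Longrightarrow> y \<in> carrier M \<Longrightarrow> f (x \<oplus>\<^bsub>M\<^esub> y) = f x \<oplus>\<^bsub>N\<^esub> f y"
    and linear_maps_smult: "c \<in> carrier k \<Longrightarrow> x \<in> carrier M \<Longrightarrow> f (c \<odot>\<^bsub>M\<^esub> x) = c \<odot>\<^bsub>N\<^esub> f x"
  using assms by (auto simp: linear_maps_def)

lemma linear_maps_zero:
  assumes "module k M" "module k N" "f \<in> linear_maps k M N"
  shows "f \<zero>\<^bsub>M\<^esub> = \<zero>\<^bsub>N\<^esub>"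
proof -
  interpret M: module k M by fact
  interpret N: module k N by fact
  have "f (\<zero>\<^bsub>k\<^esub> \<odot>\<^bsub>M\<^esub> \<zero>\<^bsub>M\<^esub>) = \<zero>\<^bsub>k\<^esub> \<odot>\<^bsub>N\<^esub> f \<zero>\<^bsub>M\<^esub>"
    using assms(3) by (intro linear_maps_smult) auto
  then show ?thesis
    using linear_maps_closed[OF assms(3)] by simp
qed

lemma linear_maps_comp:
  assumes "f \<in> linear_maps k M N" "g \<in> linear_maps k N P"
  shows "(\<lambda>x. g (f x)) \<in> linear_maps k M P"
  using assms by (auto simp: linear_maps_def Pi_def)

lemma linear_maps_minus:
  assumes "module k M" "module k N" "f \<in> linear_maps k M N" "x \<in> carrier M" "y \<in> carrier M"
  shows "f (x \<ominus>\<^bsub>M\<^esub> y) = f x \<ominus>\<^bsub>N\<^esub> f y"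
proof -
  interpret M: module k M by fact
  interpret N: module k N by fact
  have c: "f x \<in> carrier N" "f y \<in> carrier N"
    using assms linear_maps_closed by metis+
  have "\<ominus>\<^bsub>M\<^esub> y = (\<ominus>\<^bsub>k\<^esub> \<one>\<^bsub>k\<^esub>) \<odot>\<^bsub>M\<^esub> y"
    using assms by (simp add: M.smult_l_minus)
  then have "f (\<ominus>\<^bsub>M\<^esub> y) = (\<ominus>\<^bsub>k\<^esub> \<one>\<^bsub>k\<^esub>) \<odot>\<^bsub>N\<^esub> f y"
    using assms by (simp add: linear_maps_smult[OF assms(3)])
  also have "\<dots> = \<ominus>\<^bsub>N\<^esub> f y"
    using c by (simp add: N.smult_l_minus)
  finally show ?thesis
    using assms by (simp add: a_minus_def linear_maps_add[OF assms(3)])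
qed

lemma linear_maps_inj_onI:
  assumes "module k M" "module k N" "f \<in> linear_maps k M N"
    and ker: "\<And>x. x \<in> carrier M \<Longrightarrow> f x = \<zero>\<^bsub>N\<^esub> \<Longrightarrow> x = \<zero>\<^bsub>M\<^esub>"
  shows "inj_on f (carrier M)"
proof (rule inj_onI)
  interpret M: module k M by fact
  interpret N: module k N by fact
  fix x y assume xy: "x \<in> carrier M" "y \<in> carrier M" "f x = f y"
  then have "f (x \<ominus>\<^bsub>M\<^esub> y) = f y \<ominus>\<^bsub>N\<^esub> f y"
    using linear_maps_minus[OF assms(1-3)] by metis
  also have "\<dots> = \<zero>\<^bsub>N\<^esub>"
    using linear_maps_closed[OF assms(3) xy(2)] by (simp add: a_minus_def N.r_neg)
  finally have "f (x \<ominus>\<^bsub>M\<^esub> y) = \<zero>\<^bsub>N\<^esub>" .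
  then have "x \<ominus>\<^bsub>M\<^esub> y = \<zero>\<^bsub>M\<^esub>" using ker xy by simp
  moreover have "x = (x \<ominus>\<^bsub>M\<^esub> y) \<oplus>\<^bsub>M\<^esub> y" using xy by (simp add: a_minus_def M.a_assoc M.l_neg)
  ultimately show "x = y" using xy by simp
qed

text \<open>Closure under negation follows from closure under scalars.\<close>

lemma submodule_closedI:
  assumes "module k M" "H \<subseteq> carrier M" "\<zero>\<^bsub>M\<^esub> \<in> H"
    and "\<And>a b. a \<in> H \<Longrightarrow> b \<in> H \<Longrightarrow> a \<oplus>\<^bsub>M\<^esub> b \<in> H"
    and smult: "\<And>c x. c \<in> carrier k \<Longrightarrow> x \<in> H \<Longrightarrow> c \<odot>\<^bsub>M\<^esub> x \<in> H"
  shows "submodule H k M"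
proof -
  interpret M: module k M by fact
  show ?thesis
  proof (rule M.submoduleI)
    fix a assume a: "a \<in> H"
    have "(\<ominus>\<^bsub>k\<^esub> \<one>\<^bsub>k\<^esub>) \<odot>\<^bsub>M\<^esub> a \<in> H" using a by (intro smult) auto
    moreover have "(\<ominus>\<^bsub>k\<^esub> \<one>\<^bsub>k\<^esub>) \<odot>\<^bsub>M\<^esub> a = \<ominus>\<^bsub>M\<^esub> a"
      using a assms(2) by (simp add: M.smult_l_minus subset_iff)
    ultimately show "\<ominus>\<^bsub>M\<^esub> a \<in> H" by simp
  qed (use assms in auto)
qed

lemma submodule_closed:
  assumes "submodule H k M"
  shows submodule_subset: "H \<subseteq> carrier M"
    and submodule_carrier: "x \<in> H \<Longrightarrow> x \<in> carrier M"
    and submodule_zero: "\<zero>\<^bsub>M\<^esub> \<in> H"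
    and submodule_add: "x \<in> H \<Longrightarrow> y \<in> H \<Longrightarrow> x \<oplus>\<^bsub>M\<^esub> y \<in> H"
    and submodule_smult: "c \<in> carrier k \<Longrightarrow> x \<in> H \<Longrightarrow> c \<odot>\<^bsub>M\<^esub> x \<in> H"
proof -
  interpret submodule H k M by fact
  show "H \<subseteq> carrier M" "x \<in> H \<Longrightarrow> x \<in> carrier M"
    "\<zero>\<^bsub>M\<^esub> \<in> H" "x \<in> H \<Longrightarrow> y \<in> H \<Longrightarrow> x \<oplus>\<^bsub>M\<^esub> y \<in> H"
    "c \<in> carrier k \<Longrightarrow> x \<in> H \<Longrightarrow> c \<odot>\<^bsub>M\<^esub> x \<in> H"
    using subset one_closed m_closed smult_closed by auto
qed

lemma submodule_Inter:
  assumes "module k M" "\<A> \<noteq> {}" "\<And>H. H \<in> \<A> \<Longrightarrow> submodule H k M"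
  shows "submodule (\<Inter>\<A>) k M"
proof (rule submodule_closedI[OF assms(1)])
  show "\<Inter>\<A> \<subseteq> carrier M" using assms(2) submodule_subset[OF assms(3)] by blast
next
  show "\<zero>\<^bsub>M\<^esub> \<in> \<Inter>\<A>" using submodule_zero[OF assms(3)] by blast
next
  fix a b assume "a \<in> \<Inter>\<A>" "b \<in> \<Inter>\<A>"
  then show "a \<oplus>\<^bsub>M\<^esub> b \<in> \<Inter>\<A>" using submodule_add[OF assms(3)] by simp
next
  fix c x assume "c \<in> carrier k" "x \<in> \<Inter>\<A>"
  then show "c \<odot>\<^bsub>M\<^esub> x \<in> \<Inter>\<A>" using submodule_smult[OF assms(3)] by simp
qed

lemma submodule_vimage:
  assumes "module k M" "module k N" "f \<in> linear_maps k M N" "submodule Y k N"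
  shows "submodule {x \<in> carrier M. f x \<in> Y} k M"
proof -
  interpret M: module k M by fact
  show ?thesis
    using assms
    by (intro submodule_closedI)
      (auto simp: linear_maps_zero linear_maps_add linear_maps_smult
        intro: submodule_zero submodule_add submodule_smult)
qed

lemma submodule_trivial: "module k M \<Longrightarrow> submodule {\<zero>\<^bsub>M\<^esub>} k M"
proof -
  assume M: "module k M"
  interpret M: module k M by fact
  show "submodule {\<zero>\<^bsub>M\<^esub>} k M" by (rule submodule_closedI) (auto simp: M)
qed

lemma submodule_generated:
  assumes "module k M" "S \<subseteq> carrier M"
  shows "submodule (generated_submodule k M S) k M"
  unfolding generated_submodule_def
  using assms module.carrier_is_submodule[OF assms(1)] by (intro submodule_Inter) auto

lemma generated_submodule_least:
  "submodule H k M \<Longrightarrow> S \<subseteq> H \<Longrightarrow> generated_submodule k M S \<subseteq> H"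
  by (auto simp: generated_submodule_def)

lemma generated_submodule_superset: "S \<subseteq> generated_submodule k M S"
  by (auto simp: generated_submodule_def)


section \<open>Free modules and quotients\<close>

lemma free_module_simps:
  "carrier (free_module k S) =
    {f. (\<forall>s\<in>S. f s \<in> carrier k) \<and> (\<forall>s. s \<notin> S \<longrightarrow> f s = \<zero>\<^bsub>k\<^esub>) \<and> finite {s. f s \<noteq> \<zero>\<^bsub>k\<^esub>}}"
  "\<zero>\<^bsub>free_module k S\<^esub> = (\<lambda>s. \<zero>\<^bsub>k\<^esub>)"
  "f \<oplus>\<^bsub>free_module k S\<^esub> g = (\<lambda>s. f s \<oplus>\<^bsub>k\<^esub> g s)"
  "c \<odot>\<^bsub>free_module k S\<^esub> f = (\<lambda>s. c \<otimes>\<^bsub>k\<^esub> f s)"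
  by (simp_all add: free_module_def)

lemma free_module_coeff:
  assumes "cring k" "f \<in> carrier (free_module k S)"
  shows "f s \<in> carrier k"
proof -
  interpret cring k by fact
  show ?thesis using assms(2) by (cases "s \<in> S") (auto simp: free_module_simps)
qed

lemma free_module_module:
  assumes "cring k"
  shows "module k (free_module k S)"
proof -
  interpret cring k by fact
  note coeff = free_module_coeff[OF assms, of _ S]
  have add: "(\<lambda>s. f s \<oplus>\<^bsub>k\<^esub> g s) \<in> carrier (free_module k S)"
    if "f \<in> carrier (free_module k S)" "g \<in> carrier (free_module k S)" for f g
  proof -
    have "{s. f s \<oplus>\<^bsub>k\<^esub> g s \<noteq> \<zero>\<^bsub>k\<^esub>} \<subseteq> {s. f s \<noteq> \<zero>\<^bsub>k\<^esub>} \<union> {s. g s \<noteq> \<zero>\<^bsub>k\<^esub>}" by auto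
    then have "finite {s. f s \<oplus>\<^bsub>k\<^esub> g s \<noteq> \<zero>\<^bsub>k\<^esub>}"
      using that by (elim finite_subset) (auto simp: free_module_simps)
    then show ?thesis using that by (auto simp: free_module_simps)
  qed
  have smult: "(\<lambda>s. c \<otimes>\<^bsub>k\<^esub> f s) \<in> carrier (free_module k S)"
    if "c \<in> carrier k" "f \<in> carrier (free_module k S)" for c f
  proof -
    have "{s. c \<otimes>\<^bsub>k\<^esub> f s \<noteq> \<zero>\<^bsub>k\<^esub>} \<subseteq> {s. f s \<noteq> \<zero>\<^bsub>k\<^esub>}" using that by auto
    then have "finite {s. c \<otimes>\<^bsub>k\<^esub> f s \<noteq> \<zero>\<^bsub>k\<^esub>}"
      using that by (elim finite_subset) (auto simp: free_module_simps)
    then show ?thesis using that by (auto simp: free_module_simps)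
  qed
  have neg: "\<exists>g\<in>carrier (free_module k S). g \<oplus>\<^bsub>free_module k S\<^esub> f = \<zero>\<^bsub>free_module k S\<^esub>"
    if "f \<in> carrier (free_module k S)" for f
  proof
    show "(\<lambda>s. (\<ominus>\<^bsub>k\<^esub> \<one>\<^bsub>k\<^esub>) \<otimes>\<^bsub>k\<^esub> f s) \<in> carrier (free_module k S)"
      using that by (intro smult) auto
    show "(\<lambda>s. (\<ominus>\<^bsub>k\<^esub> \<one>\<^bsub>k\<^esub>) \<otimes>\<^bsub>k\<^esub> f s) \<oplus>\<^bsub>free_module k S\<^esub> f = \<zero>\<^bsub>free_module k S\<^esub>"
      using coeff[OF that] by (simp add: free_module_simps(2-) l_minus l_neg)
  qed
  show ?thesis
  proof (rule moduleI)
    show "abelian_group (free_module k S)"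
    proof (rule abelian_groupI)
      show "\<zero>\<^bsub>free_module k S\<^esub> \<in> carrier (free_module k S)" by (simp add: free_module_simps)
    qed (use add neg coeff in \<open>auto simp: free_module_simps(2-) a_ac\<close>)
  qed (use smult coeff assms in \<open>auto simp: free_module_simps(2-) l_distr r_distr m_assoc\<close>)
qed

lemma basis_vector_closed:
  assumes "cring k" "s \<in> S"
  shows "basis_vector k s \<in> carrier (free_module k S)"
proof -
  interpret cring k by fact
  have "{t. basis_vector k s t \<noteq> \<zero>\<^bsub>k\<^esub>} \<subseteq> {s}" by (auto simp: basis_vector_def)
  then have "finite {t. basis_vector k s t \<noteq> \<zero>\<^bsub>k\<^esub>}" by (rule finite_subset) simp
  then show ?thesis using assms(2) by (auto simp: free_module_simps basis_vector_def)
qed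

lemma free_module_induct [consumes 2, case_names zero step]:
  assumes k: "cring k" and f: "f \<in> carrier (free_module k S)"
    and zero: "P \<zero>\<^bsub>free_module k S\<^esub>"
    and step: "\<And>c s g. c \<in> carrier k \<Longrightarrow> s \<in> S \<Longrightarrow> g \<in> carrier (free_module k S) \<Longrightarrow> P g \<Longrightarrow>
      P (c \<odot>\<^bsub>free_module k S\<^esub> basis_vector k s \<oplus>\<^bsub>free_module k S\<^esub> g)"
  shows "P f"
proof -
  interpret cring k by fact
  have "P f" if "finite T" "f \<in> carrier (free_module k S)" "{s. f s \<noteq> \<zero>\<^bsub>k\<^esub>} \<subseteq> T" for f T
    using that
  proof (induction T arbitrary: f rule: finite_induct)
    case empty
    then have "f = \<zero>\<^bsub>free_module k S\<^esub>" by (auto simp: free_module_simps)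
    then show ?case using zero by simp
  next
    case (insert t T)
    show ?case
    proof (cases "f t = \<zero>\<^bsub>k\<^esub>")
      case True
      then show ?thesis using insert.prems insert.IH by blast
    next
      case False
      define g where "g = f(t := \<zero>\<^bsub>k\<^esub>)"
      have t: "t \<in> S" using False insert.prems by (auto simp: free_module_simps)
      have "{s. g s \<noteq> \<zero>\<^bsub>k\<^esub>} \<subseteq> {s. f s \<noteq> \<zero>\<^bsub>k\<^esub>}" by (auto simp: g_def)
      then have "finite {s. g s \<noteq> \<zero>\<^bsub>k\<^esub>}"
        using insert.prems(1) by (elim finite_subset) (auto simp: free_module_simps)
      then have g: "g \<in> carrier (free_module k S)"
        using insert.prems by (auto simp: free_module_simps g_def)
      have "{s. g s \<noteq> \<zero>\<^bsub>k\<^esub>} \<subseteq> T" using insert.prems by (auto simp: g_def)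
      then have "P g" using g insert.IH by blast
      then have "P (f t \<odot>\<^bsub>free_module k S\<^esub> basis_vector k t \<oplus>\<^bsub>free_module k S\<^esub> g)"
        using t g free_module_coeff[OF k insert.prems(1)] by (intro step)
      also have "f t \<odot>\<^bsub>free_module k S\<^esub> basis_vector k t \<oplus>\<^bsub>free_module k S\<^esub> g = f"
        using free_module_coeff[OF k insert.prems(1)]
        by (auto simp: free_module_simps basis_vector_def g_def)
      finally show ?thesis .
    qed
  qed
  then show ?thesis using f by (auto simp: free_module_simps)
qed

text \<open>The linear extension of \<open>b\<close> from the basis vectors to the free module.\<close>
definition free_eval ::
    "('k, 'r) ring_scheme \<Rightarrow> ('k, 'p, 'x) module_scheme \<Rightarrow> ('s \<Rightarrow> 'p) \<Rightarrow> ('s \<Rightarrow> 'k) \<Rightarrow> 'p"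
  where "free_eval k P b f = finsum P (\<lambda>s. f s \<odot>\<^bsub>P\<^esub> b s) {s. f s \<noteq> \<zero>\<^bsub>k\<^esub>}"

lemma free_eval_superset:
  assumes "module k P" "f \<in> carrier (free_module k S)" "b \<in> S \<rightarrow> carrier P"
    and "finite T" "{s. f s \<noteq> \<zero>\<^bsub>k\<^esub>} \<subseteq> T" "T \<subseteq> S"
  shows "free_eval k P b f = finsum P (\<lambda>s. f s \<odot>\<^bsub>P\<^esub> b s) T"
proof -
  interpret P: module k P by fact
  note coeff = free_module_coeff[OF P.R.is_cring assms(2)]
  show ?thesis unfolding free_eval_def
    using assms coeff by (intro P.add.finprod_mono_neutral_cong_left) (auto simp: Pi_iff subset_iff)
qed

lemma free_eval_linear:
  assumes "module k P" "b \<in> S \<rightarrow> carrier P"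
  shows "free_eval k P b \<in> linear_maps k (free_module k S) P"
proof -
  interpret P: module k P by fact
  note coeff = free_module_coeff[OF P.R.is_cring]
  interpret F: module k "free_module k S" by (rule free_module_module[OF P.R.is_cring])
  have supp: "finite {s. f s \<noteq> \<zero>\<^bsub>k\<^esub>}" "{s. f s \<noteq> \<zero>\<^bsub>k\<^esub>} \<subseteq> S"
    if "f \<in> carrier (free_module k S)" for f
    using that by (auto simp: free_module_simps)
  have closed: "f s \<odot>\<^bsub>P\<^esub> b s \<in> carrier P" if "f \<in> carrier (free_module k S)" "s \<in> S" for f s
    using that coeff[of f S] assms(2) by auto
  show ?thesis
  proof (rule linear_mapsI)
    fix f assume f: "f \<in> carrier (free_module k S)"
    show "free_eval k P b f \<in> carrier P"
      unfolding free_eval_def using closed[OF f] supp[OF f] by (intro P.finsum_closed) auto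
    fix g assume g: "g \<in> carrier (free_module k S)"
    define T where "T = {s. f s \<noteq> \<zero>\<^bsub>k\<^esub>} \<union> {s. g s \<noteq> \<zero>\<^bsub>k\<^esub>}"
    have T: "finite T" "T \<subseteq> S" using supp f g by (auto simp: T_def)
    let ?h = "f \<oplus>\<^bsub>free_module k S\<^esub> g"
    have h: "?h \<in> carrier (free_module k S)" using f g by simp
    have "free_eval k P b ?h = finsum P (\<lambda>s. ?h s \<odot>\<^bsub>P\<^esub> b s) T"
      using T h assms by (intro free_eval_superset[where S = S]) (auto simp: T_def free_module_simps)
    also have "\<dots> = finsum P (\<lambda>s. f s \<odot>\<^bsub>P\<^esub> b s \<oplus>\<^bsub>P\<^esub> g s \<odot>\<^bsub>P\<^esub> b s) T"
      using T closed[OF f] closed[OF g] coeff[OF f] coeff[OF g] assms(2)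
      by (intro P.finsum_cong') (auto simp: free_module_simps P.smult_l_distr Pi_iff subset_iff)
    also have "\<dots> = finsum P (\<lambda>s. f s \<odot>\<^bsub>P\<^esub> b s) T \<oplus>\<^bsub>P\<^esub> finsum P (\<lambda>s. g s \<odot>\<^bsub>P\<^esub> b s) T"
      using T closed[OF f] closed[OF g] by (intro P.finsum_addf) auto
    also have "finsum P (\<lambda>s. f s \<odot>\<^bsub>P\<^esub> b s) T = free_eval k P b f"
      using T f assms by (intro free_eval_superset[where S = S, symmetric]) (auto simp: T_def)
    also have "finsum P (\<lambda>s. g s \<odot>\<^bsub>P\<^esub> b s) T = free_eval k P b g"
      using T g assms by (intro free_eval_superset[where S = S, symmetric]) (auto simp: T_def)
    finally show "free_eval k P b ?h = free_eval k P b f \<oplus>\<^bsub>P\<^esub> free_eval k P b g" .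
  next
    fix c f assume c: "c \<in> carrier k" and f: "f \<in> carrier (free_module k S)"
    let ?T = "{s. f s \<noteq> \<zero>\<^bsub>k\<^esub>}" and ?h = "c \<odot>\<^bsub>free_module k S\<^esub> f"
    have h: "?h \<in> carrier (free_module k S)" using c f by simp
    have "free_eval k P b ?h = finsum P (\<lambda>s. ?h s \<odot>\<^bsub>P\<^esub> b s) ?T"
      using supp[OF f] h assms c by (intro free_eval_superset[where S = S]) (auto simp: free_module_simps)
    also have "\<dots> = finsum P (\<lambda>s. c \<odot>\<^bsub>P\<^esub> (f s \<odot>\<^bsub>P\<^esub> b s)) ?T"
      using c supp[OF f] closed[OF f] coeff[OF f] assms(2)
      by (intro P.finsum_cong') (auto simp: free_module_simps P.smult_assoc1 Pi_iff subset_iff)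
    also have "\<dots> = c \<odot>\<^bsub>P\<^esub> free_eval k P b f"
      unfolding free_eval_def
      using c supp[OF f] closed[OF f] by (intro P.finsum_smult_ldistr[symmetric]) auto
    finally show "free_eval k P b ?h = c \<odot>\<^bsub>P\<^esub> free_eval k P b f" .
  qed
qed

lemma free_eval_basis_vector:
  assumes "module k P" "b \<in> S \<rightarrow> carrier P" "s \<in> S"
  shows "free_eval k P b (basis_vector k s) = b s"
proof -
  interpret P: module k P by fact
  have "free_eval k P b (basis_vector k s) = finsum P (\<lambda>t. basis_vector k s t \<odot>\<^bsub>P\<^esub> b t) {s}"
    using assms basis_vector_closed[OF P.R.is_cring assms(3)]
    by (intro free_eval_superset[where S = S]) (auto simp: basis_vector_def)
  also have "\<dots> = b s" using assms by (simp add: basis_vector_def Pi_iff)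
  finally show ?thesis .
qed

lemma quotient_module_facts:
  assumes "module k M" "submodule K k M"
  shows quotient_module_module: "module k (quotient_module k M K)"
    and quotient_projection_linear: "(\<lambda>x. K +>\<^bsub>M\<^esub> x) \<in> linear_maps k M (quotient_module k M K)"
proof -
  interpret M: module k M by fact
  interpret K: abelian_subgroup K M
    by (rule abelian_subgroupI3[OF additive_subgroup.intro M.abelian_group_axioms])
      (rule submodule.axioms(1)[OF assms(2)])
  let ?Q = "quotient_module k M K"
  have carr: "carrier ?Q = {K +>\<^bsub>M\<^esub> x | x. x \<in> carrier M}"
    by (auto simp: quotient_module_def A_RCOSETS_def')
  have rep: "\<exists>x. x \<in> carrier M \<and> T = K +>\<^bsub>M\<^esub> x" if "T \<in> carrier ?Q" for T
    using that carr by auto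
  have add: "(K +>\<^bsub>M\<^esub> x) \<oplus>\<^bsub>?Q\<^esub> (K +>\<^bsub>M\<^esub> y) = K +>\<^bsub>M\<^esub> (x \<oplus>\<^bsub>M\<^esub> y)"
    if "x \<in> carrier M" "y \<in> carrier M" for x y
    using K.a_rcos_sum that by (simp add: quotient_module_def)
  have smult: "c \<odot>\<^bsub>?Q\<^esub> (K +>\<^bsub>M\<^esub> x) = K +>\<^bsub>M\<^esub> (c \<odot>\<^bsub>M\<^esub> x)"
    if c: "c \<in> carrier k" and x: "x \<in> carrier M" for c x
  proof -
    have const: "K +>\<^bsub>M\<^esub> (c \<odot>\<^bsub>M\<^esub> y) = K +>\<^bsub>M\<^esub> (c \<odot>\<^bsub>M\<^esub> x)" if y: "y \<in> K +>\<^bsub>M\<^esub> x" for y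
    proof -
      obtain h where h: "h \<in> K" "y = h \<oplus>\<^bsub>M\<^esub> x" using y by (auto simp: a_r_coset_def')
      have "c \<odot>\<^bsub>M\<^esub> y = c \<odot>\<^bsub>M\<^esub> h \<oplus>\<^bsub>M\<^esub> c \<odot>\<^bsub>M\<^esub> x"
        using h c x submodule_carrier[OF assms(2)] by (simp add: M.smult_r_distr)
      then have "c \<odot>\<^bsub>M\<^esub> y \<in> K +>\<^bsub>M\<^esub> (c \<odot>\<^bsub>M\<^esub> x)"
        using submodule_smult[OF assms(2) c h(1)] by (auto simp: a_r_coset_def')
      then show ?thesis using K.a_repr_independence'[of "c \<odot>\<^bsub>M\<^esub> y"] c x by simp
    qed
    have "c \<odot>\<^bsub>?Q\<^esub> (K +>\<^bsub>M\<^esub> x) = (\<Union>y\<in>K +>\<^bsub>M\<^esub> x. K +>\<^bsub>M\<^esub> (c \<odot>\<^bsub>M\<^esub> y))"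
      by (simp add: quotient_module_def)
    also have "\<dots> = (\<Union>y\<in>K +>\<^bsub>M\<^esub> x. K +>\<^bsub>M\<^esub> (c \<odot>\<^bsub>M\<^esub> x))"
      using const by (rule SUP_cong[OF refl])
    also have "\<dots> = K +>\<^bsub>M\<^esub> (c \<odot>\<^bsub>M\<^esub> x)" using K.a_rcos_self[OF x] by (intro SUP_const) blast
    finally show ?thesis .
  qed
  have zero: "\<zero>\<^bsub>?Q\<^esub> = K +>\<^bsub>M\<^esub> \<zero>\<^bsub>M\<^esub>"
    using submodule_subset[OF assms(2)] by (simp add: quotient_module_def)
  have closed: "K +>\<^bsub>M\<^esub> x \<in> carrier ?Q" if "x \<in> carrier M" for x using that carr by auto
  show "(\<lambda>x. K +>\<^bsub>M\<^esub> x) \<in> linear_maps k M ?Q"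
    by (rule linear_mapsI) (auto simp: add smult closed)
  show "module k ?Q"
  proof (rule moduleI)
    show "abelian_group ?Q"
    proof (rule abelian_groupI)
      fix T assume "T \<in> carrier ?Q"
      then obtain x where x: "x \<in> carrier M" "T = K +>\<^bsub>M\<^esub> x" using rep by blast
      then show "\<exists>S\<in>carrier ?Q. S \<oplus>\<^bsub>?Q\<^esub> T = \<zero>\<^bsub>?Q\<^esub>"
        by (intro bexI[of _ "K +>\<^bsub>M\<^esub> (\<ominus>\<^bsub>M\<^esub> x)"]) (auto simp: add zero closed M.l_neg)
    qed (auto dest!: rep simp: add zero closed M.a_ac)
  qed (auto dest!: rep simp: add smult closed M.R.is_cring M.smult_l_distr M.smult_r_distr M.smult_assoc1)
qed

lemma quotient_projection_eqI:
  assumes "module k M" "submodule K k M" "x \<in> carrier M" "y \<in> carrier M" "x \<ominus>\<^bsub>M\<^esub> y \<in> K"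
  shows "K +>\<^bsub>M\<^esub> x = K +>\<^bsub>M\<^esub> y"
proof -
  interpret M: module k M by fact
  have "x = (x \<ominus>\<^bsub>M\<^esub> y) \<oplus>\<^bsub>M\<^esub> y" using assms(3,4) by (simp add: a_minus_def M.a_assoc M.l_neg)
  then have "x \<in> K +>\<^bsub>M\<^esub> y" using assms(5) by (auto simp: a_r_coset_def')
  then show ?thesis
    using M.a_repr_independence[OF _ assms(4) submodule.axioms(1)[OF assms(2)]] by simp
qed

lemma quotient_module_representative:
  assumes "T \<in> carrier (quotient_module k M K)"
  obtains x where "x \<in> carrier M" "T = K +>\<^bsub>M\<^esub> x"
  using assms by (auto simp: quotient_module_def A_RCOSETS_def')

text \<open>
  A linear map that vanishes on \<open>K\<close> takes the same value on all elements of a coset, hence also on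
  the one selected by the choice operator.
\<close>
lemma linear_maps_on_coset:
  assumes "module k M" "module k N" "submodule K k M" "h \<in> linear_maps k M N"
    and "\<And>x. x \<in> K \<Longrightarrow> h x = \<zero>\<^bsub>N\<^esub>" and x: "x \<in> carrier M"
  shows "h (SOME y. y \<in> K +>\<^bsub>M\<^esub> x) = h x"
proof -
  interpret M: module k M by fact
  interpret N: module k N by fact
  have "\<zero>\<^bsub>M\<^esub> \<oplus>\<^bsub>M\<^esub> x \<in> K +>\<^bsub>M\<^esub> x"
    using submodule_zero[OF assms(3)] by (auto simp: a_r_coset_def')
  then have "(SOME y. y \<in> K +>\<^bsub>M\<^esub> x) \<in> K +>\<^bsub>M\<^esub> x" by (rule someI)
  then obtain z where "z \<in> K" "(SOME y. y \<in> K +>\<^bsub>M\<^esub> x) = z \<oplus>\<^bsub>M\<^esub> x"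
    by (auto simp: a_r_coset_def')
  then show ?thesis
    using assms(5) x submodule_carrier[OF assms(3)] linear_maps_closed[OF assms(4)]
    by (simp add: linear_maps_add[OF assms(4)])
qed

section \<open>Tensor products\<close>

definition bilinear_map ::
    "('k, 'r) ring_scheme \<Rightarrow> ('k, 'm, 'x) module_scheme \<Rightarrow> ('k, 'n, 'y) module_scheme
      \<Rightarrow> ('k, 'p, 'z) module_scheme \<Rightarrow> ('m \<Rightarrow> 'n \<Rightarrow> 'p) \<Rightarrow> bool"
  where "bilinear_map k M N P b \<longleftrightarrow>
    (\<forall>x\<in>carrier M. b x \<in> linear_maps k N P) \<and> (\<forall>y\<in>carrier N. (\<lambda>x. b x y) \<in> linear_maps k M P)"

lemma bilinear_mapD:
  assumes "bilinear_map k M N P b"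
  shows bilinear_map_closed: "x \<in> carrier M \<Longrightarrow> y \<in> carrier N \<Longrightarrow> b x y \<in> carrier P"
    and bilinear_map_add_left: "x \<in> carrier M \<Longrightarrow> x' \<in> carrier M \<Longrightarrow> y \<in> carrier N \<Longrightarrow>
      b (x \<oplus>\<^bsub>M\<^esub> x') y = b x y \<oplus>\<^bsub>P\<^esub> b x' y"
    and bilinear_map_add_right: "x \<in> carrier M \<Longrightarrow> y \<in> carrier N \<Longrightarrow> y' \<in> carrier N \<Longrightarrow>
      b x (y \<oplus>\<^bsub>N\<^esub> y') = b x y \<oplus>\<^bsub>P\<^esub> b x y'"
    and bilinear_map_smult_left: "c \<in> carrier k \<Longrightarrow> x \<in> carrier M \<Longrightarrow> y \<in> carrier N \<Longrightarrow>
      b (c \<odot>\<^bsub>M\<^esub> x) y = c \<odot>\<^bsub>P\<^esub> b x y"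
    and bilinear_map_smult_right: "c \<in> carrier k \<Longrightarrow> x \<in> carrier M \<Longrightarrow> y \<in> carrier N \<Longrightarrow>
      b x (c \<odot>\<^bsub>N\<^esub> y) = c \<odot>\<^bsub>P\<^esub> b x y"
  using assms by (auto simp: bilinear_map_def linear_maps_def Pi_def)

lemma bilinear_map_comp:
  assumes "bilinear_map k M N P b" "f \<in> linear_maps k U M" "g \<in> linear_maps k V N"
  shows "bilinear_map k U V P (\<lambda>u v. b (f u) (g v))"
  using assms by (auto simp: bilinear_map_def linear_maps_def Pi_def)

text \<open>
  These are the bilinear maps behind slices and counits.
\<close>
lemma bilinear_smult_left:
  assumes "module k N" "f \<in> linear_maps k M (self_module k)"
  shows "bilinear_map k M N N (\<lambda>x y. f x \<odot>\<^bsub>N\<^esub> y)"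
proof -
  interpret N: module k N by fact
  show ?thesis
    using assms(2)
    by (auto simp: bilinear_map_def linear_maps_def Pi_def self_module_def N.smult_l_distr
        N.smult_r_distr N.smult_assoc1[symmetric] N.R.m_comm)
qed

lemma bilinear_map_flip:
  "bilinear_map k M N P b \<Longrightarrow> bilinear_map k N M P (\<lambda>y x. b x y)"
  by (simp add: bilinear_map_def)

lemma bilinear_relations_closed:
  assumes "module k M" "module k N"
  shows "bilinear_relations k M N \<subseteq> carrier (free_module k (carrier M \<times> carrier N))"
proof -
  interpret M: module k M by fact
  interpret N: module k N by fact
  let ?S = "carrier M \<times> carrier N"
  interpret F: module k "free_module k ?S" by (rule free_module_module[OF M.R.is_cring])
  have e: "basis_vector k (x, y) \<in> carrier (free_module k ?S)"
    if "x \<in> carrier M" "y \<in> carrier N" for x y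
    using that by (intro basis_vector_closed M.R.is_cring) auto
  show ?thesis
    unfolding bilinear_relations_def Let_def by (auto intro!: e F.minus_closed F.a_closed F.smult_closed)
qed

lemma tensor_kernel_submodule:
  assumes "module k M" "module k N"
  shows "submodule (tensor_kernel k M N) k (free_module k (carrier M \<times> carrier N))"
  unfolding tensor_kernel_def
  using assms bilinear_relations_closed[OF assms]
  by (intro submodule_generated free_module_module) (auto simp: module_def)

lemma tensor_product_module:
  assumes "module k M" "module k N"
  shows "module k (tensor_product k M N)"
  unfolding tensor_product_def using assms
  by (intro quotient_module_module tensor_kernel_submodule free_module_module) (auto simp: module_def)

text \<open>
  The linear extension of \<open>b\<close> to the free module sends the defining relations to zero because \<open>b\<close> is
  bilinear, and its kernel is a submodule, so it contains the submodule that they generate.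
\<close>
lemma free_eval_tensor_kernel:
  assumes M: "module k M" and N: "module k N" and P: "module k P" and b: "bilinear_map k M N P b"
    and "f \<in> tensor_kernel k M N"
  shows "free_eval k P (case_prod b) f = \<zero>\<^bsub>P\<^esub>"
proof -
  let ?F = "free_module k (carrier M \<times> carrier N)" and ?h = "free_eval k P (case_prod b)"
  interpret M: module k M by fact
  interpret N: module k N by fact
  interpret P: module k P by fact
  note F = free_module_module[OF M.R.is_cring, of "carrier M \<times> carrier N"]
  interpret F: module k ?F by (rule F)
  have b': "case_prod b \<in> carrier M \<times> carrier N \<rightarrow> carrier P"
    using bilinear_map_closed[OF b] by auto
  note lin = free_eval_linear[OF P b']
  have e: "basis_vector k (x, y) \<in> carrier ?F" if "x \<in> carrier M" "y \<in> carrier N" for x y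
    using that by (intro basis_vector_closed M.R.is_cring) auto
  have he: "?h (basis_vector k (x, y)) = b x y" if "x \<in> carrier M" "y \<in> carrier N" for x y
    using free_eval_basis_vector[OF P b', of "(x, y)"] that by auto
  have h0: "?h (u \<ominus>\<^bsub>?F\<^esub> v) = \<zero>\<^bsub>P\<^esub>" if "u \<in> carrier ?F" "v \<in> carrier ?F" "?h u = ?h v" for u v
    using that linear_maps_closed[OF lin that(2)]
    by (simp add: linear_maps_minus[OF F P lin]) (simp add: a_minus_def P.r_neg)
  have "bilinear_relations k M N \<subseteq> {f \<in> carrier ?F. ?h f \<in> {\<zero>\<^bsub>P\<^esub>}}"
    unfolding bilinear_relations_def Let_def
    by (auto intro!: h0 simp: e he linear_maps_add[OF lin] linear_maps_smult[OF lin] bilinear_mapD[OF b])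
  then have "tensor_kernel k M N \<subseteq> {f \<in> carrier ?F. ?h f \<in> {\<zero>\<^bsub>P\<^esub>}}"
    unfolding tensor_kernel_def
    by (intro generated_submodule_least submodule_vimage[OF F P lin] submodule_trivial[OF P])
  then show ?thesis using assms(5) by auto
qed

lemma tensor_lift_coset:
  assumes M: "module k M" and N: "module k N" and P: "module k P" and b: "bilinear_map k M N P b"
    and f: "f \<in> carrier (free_module k (carrier M \<times> carrier N))"
  shows "tensor_lift k P b (tensor_kernel k M N +>\<^bsub>free_module k (carrier M \<times> carrier N)\<^esub> f)
    = free_eval k P (case_prod b) f"
proof -
  have k: "cring k" using M by (simp add: module_def)
  have "case_prod b \<in> carrier M \<times> carrier N \<rightarrow> carrier P"
    using bilinear_map_closed[OF b] by auto
  note lin = free_eval_linear[OF P this]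
  have eq: "tensor_lift k P b t = free_eval k P (case_prod b) (SOME f. f \<in> t)" for t
    by (simp add: tensor_lift_def free_eval_def case_prod_unfold Let_def)
  show ?thesis
    unfolding eq
    by (rule linear_maps_on_coset[OF free_module_module[OF k] P tensor_kernel_submodule[OF M N] lin
          free_eval_tensor_kernel[OF M N P b] f])
qed

lemma tensor_lift_linear:
  assumes M: "module k M" and N: "module k N" and P: "module k P" and b: "bilinear_map k M N P b"
  shows "tensor_lift k P b \<in> linear_maps k (tensor_product k M N) P"
proof -
  let ?F = "free_module k (carrier M \<times> carrier N)" and ?K = "tensor_kernel k M N"
  have k: "cring k" using M by (simp add: module_def)
  interpret F: module k ?F by (rule free_module_module[OF k])
  have "case_prod b \<in> carrier M \<times> carrier N \<rightarrow> carrier P"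
    using bilinear_map_closed[OF b] by auto
  note lin = free_eval_linear[OF P this]
  note proj = quotient_projection_linear[OF free_module_module[OF k] tensor_kernel_submodule[OF M N],
      folded tensor_product_def]
  note lift = tensor_lift_coset[OF M N P b]
  have rep: "\<exists>f. f \<in> carrier ?F \<and> t = ?K +>\<^bsub>?F\<^esub> f" if "t \<in> carrier (tensor_product k M N)" for t
    using that unfolding tensor_product_def by (elim quotient_module_representative) blast
  show ?thesis
  proof (rule linear_mapsI)
    fix t assume "t \<in> carrier (tensor_product k M N)"
    then obtain f where f: "f \<in> carrier ?F" "t = ?K +>\<^bsub>?F\<^esub> f" using rep by blast
    show "tensor_lift k P b t \<in> carrier P"
      using f linear_maps_closed[OF lin f(1)] by (simp add: lift)
    fix u assume "u \<in> carrier (tensor_product k M N)"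
    then obtain g where g: "g \<in> carrier ?F" "u = ?K +>\<^bsub>?F\<^esub> g" using rep by blast
    show "tensor_lift k P b (t \<oplus>\<^bsub>tensor_product k M N\<^esub> u) = tensor_lift k P b t \<oplus>\<^bsub>P\<^esub> tensor_lift k P b u"
      using f g by (simp add: linear_maps_add[OF proj, symmetric] lift linear_maps_add[OF lin])
  next
    fix c t assume c: "c \<in> carrier k" and "t \<in> carrier (tensor_product k M N)"
    then obtain f where f: "f \<in> carrier ?F" "t = ?K +>\<^bsub>?F\<^esub> f" using rep by blast
    show "tensor_lift k P b (c \<odot>\<^bsub>tensor_product k M N\<^esub> t) = c \<odot>\<^bsub>P\<^esub> tensor_lift k P b t"
      using c f by (simp add: linear_maps_smult[OF proj, symmetric] lift linear_maps_smult[OF lin])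
  qed
qed

lemma tensor_lift_pure:
  assumes M: "module k M" and N: "module k N" and P: "module k P" and b: "bilinear_map k M N P b"
    and "x \<in> carrier M" "y \<in> carrier N"
  shows "tensor_lift k P b (pure_tensor k M N x y) = b x y"
proof -
  have k: "cring k" using M by (simp add: module_def)
  have "case_prod b \<in> carrier M \<times> carrier N \<rightarrow> carrier P"
    using bilinear_map_closed[OF b] by auto
  then have "free_eval k P (case_prod b) (basis_vector k (x, y)) = case_prod b (x, y)"
    using assms(5,6) by (intro free_eval_basis_vector[OF P]) auto
  then show ?thesis
    unfolding pure_tensor_def
    using assms(5,6) by (subst tensor_lift_coset[OF M N P b]) (auto intro: basis_vector_closed[OF k])
qed

lemma pure_tensor_bilinear:
  assumes M: "module k M" and N: "module k N"
  shows "bilinear_map k M N (tensor_product k M N) (pure_tensor k M N)"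
proof -
  let ?F = "free_module k (carrier M \<times> carrier N)" and ?K = "tensor_kernel k M N"
    and ?T = "tensor_product k M N"
  interpret M: module k M by fact
  interpret N: module k N by fact
  note F = free_module_module[OF M.R.is_cring, of "carrier M \<times> carrier N"]
  interpret F: module k ?F by (rule F)
  note K = tensor_kernel_submodule[OF M N]
  note proj = quotient_projection_linear[OF F K, folded tensor_product_def]
  note closed = linear_maps_closed[OF proj]
  have e: "basis_vector k (x, y) \<in> carrier ?F" if "x \<in> carrier M" "y \<in> carrier N" for x y
    using that by (intro basis_vector_closed M.R.is_cring) auto
  have rel: "?K +>\<^bsub>?F\<^esub> u = ?K +>\<^bsub>?F\<^esub> v"
    if "u \<in> carrier ?F" "v \<in> carrier ?F" "u \<ominus>\<^bsub>?F\<^esub> v \<in> bilinear_relations k M N" for u v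
    using that generated_submodule_superset[of "bilinear_relations k M N"]
    by (intro quotient_projection_eqI[OF F K]) (auto simp: tensor_kernel_def)
  have add_left: "pure_tensor k M N (x \<oplus>\<^bsub>M\<^esub> x') y = pure_tensor k M N x y \<oplus>\<^bsub>?T\<^esub> pure_tensor k M N x' y"
    if "x \<in> carrier M" "x' \<in> carrier M" "y \<in> carrier N" for x x' y
    unfolding pure_tensor_def using that e
    by (subst linear_maps_add[OF proj, symmetric], simp, simp, intro rel, simp, simp)
      (unfold bilinear_relations_def Let_def, blast)
  have add_right: "pure_tensor k M N x (y \<oplus>\<^bsub>N\<^esub> y') = pure_tensor k M N x y \<oplus>\<^bsub>?T\<^esub> pure_tensor k M N x y'"
    if "x \<in> carrier M" "y \<in> carrier N" "y' \<in> carrier N" for x y y'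
    unfolding pure_tensor_def using that e
    by (subst linear_maps_add[OF proj, symmetric], simp, simp, intro rel, simp, simp)
      (unfold bilinear_relations_def Let_def, blast)
  have smult_left: "pure_tensor k M N (c \<odot>\<^bsub>M\<^esub> x) y = c \<odot>\<^bsub>?T\<^esub> pure_tensor k M N x y"
    if "c \<in> carrier k" "x \<in> carrier M" "y \<in> carrier N" for c x y
    unfolding pure_tensor_def using that e
    by (subst linear_maps_smult[OF proj, symmetric], simp, simp, intro rel, simp, simp)
      (unfold bilinear_relations_def Let_def, blast)
  have smult_right: "pure_tensor k M N x (c \<odot>\<^bsub>N\<^esub> y) = c \<odot>\<^bsub>?T\<^esub> pure_tensor k M N x y"
    if "c \<in> carrier k" "x \<in> carrier M" "y \<in> carrier N" for c x y
    unfolding pure_tensor_def using that e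
    by (subst linear_maps_smult[OF proj, symmetric], simp, simp, intro rel, simp, simp)
      (unfold bilinear_relations_def Let_def, blast)
  have pure: "pure_tensor k M N x y \<in> carrier ?T" if "x \<in> carrier M" "y \<in> carrier N" for x y
    unfolding pure_tensor_def using that e closed by simp
  show ?thesis
    unfolding bilinear_map_def
    by (intro conjI ballI linear_mapsI)
      (simp_all add: pure add_left add_right smult_left smult_right)
qed

lemmas pure_tensor_closed = bilinear_map_closed[OF pure_tensor_bilinear]

text \<open>
  Scalars need no case of their own, as they can be absorbed into the left factor of a pure tensor.
\<close>
lemma tensor_induct [consumes 3, case_names zero step]:
  assumes M: "module k M" and N: "module k N" and "t \<in> carrier (tensor_product k M N)"
    and zero: "P \<zero>\<^bsub>tensor_product k M N\<^esub>"
    and step: "\<And>x y t. x \<in> carrier M \<Longrightarrow> y \<in> carrier N \<Longrightarrow> t \<in> carrier (tensor_product k M N) \<Longrightarrow>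
      P t \<Longrightarrow> P (pure_tensor k M N x y \<oplus>\<^bsub>tensor_product k M N\<^esub> t)"
  shows "P t"
proof -
  let ?F = "free_module k (carrier M \<times> carrier N)" and ?K = "tensor_kernel k M N"
    and ?T = "tensor_product k M N"
  interpret M: module k M by fact
  have k: "cring k" by (rule M.R.is_cring)
  note F = free_module_module[OF k, of "carrier M \<times> carrier N"]
  interpret F: module k ?F by (rule F)
  note proj = quotient_projection_linear[OF F tensor_kernel_submodule[OF M N], folded tensor_product_def]
  have proj0: "?K +>\<^bsub>?F\<^esub> \<zero>\<^bsub>?F\<^esub> = \<zero>\<^bsub>?T\<^esub>"
    by (rule linear_maps_zero[OF F tensor_product_module[OF M N] proj])
  obtain f where f: "f \<in> carrier ?F" "t = ?K +>\<^bsub>?F\<^esub> f"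
    using assms(3) unfolding tensor_product_def by (rule quotient_module_representative)
  from k f(1) have "P (?K +>\<^bsub>?F\<^esub> f)"
  proof (induction rule: free_module_induct)
    case zero
    then show ?case using assms(4) proj0 by simp
  next
    case (step c s g)
    obtain x y where s: "s = (x, y)" "x \<in> carrier M" "y \<in> carrier N" using step by (cases s) auto
    have e: "basis_vector k s \<in> carrier ?F" using step k by (intro basis_vector_closed)
    have "?K +>\<^bsub>?F\<^esub> (c \<odot>\<^bsub>?F\<^esub> basis_vector k s \<oplus>\<^bsub>?F\<^esub> g)
        = c \<odot>\<^bsub>?T\<^esub> pure_tensor k M N x y \<oplus>\<^bsub>?T\<^esub> (?K +>\<^bsub>?F\<^esub> g)"
      using step e s by (simp add: linear_maps_add[OF proj] linear_maps_smult[OF proj] pure_tensor_def)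
    also have "\<dots> = pure_tensor k M N (c \<odot>\<^bsub>M\<^esub> x) y \<oplus>\<^bsub>?T\<^esub> (?K +>\<^bsub>?F\<^esub> g)"
      using step s by (simp add: bilinear_map_smult_left[OF pure_tensor_bilinear[OF M N]])
    finally show ?case
      using step s linear_maps_closed[OF proj] by (auto intro: assms(5))
  qed
  then show ?thesis using f by simp
qed

lemma tensor_linear_eqI:
  assumes M: "module k M" and N: "module k N" and P: "module k P"
    and f: "f \<in> linear_maps k (tensor_product k M N) P"
    and g: "g \<in> linear_maps k (tensor_product k M N) P"
    and pure: "\<And>x y. x \<in> carrier M \<Longrightarrow> y \<in> carrier N \<Longrightarrow>
      f (pure_tensor k M N x y) = g (pure_tensor k M N x y)"
    and t: "t \<in> carrier (tensor_product k M N)"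
  shows "f t = g t"
  using M N t
proof (induction rule: tensor_induct)
  case zero
  note T = tensor_product_module[OF M N]
  show ?case by (simp add: linear_maps_zero[OF T P f] linear_maps_zero[OF T P g])
next
  case (step x y t)
  then show ?case
    using pure pure_tensor_closed[OF M N] by (simp add: linear_maps_add[OF f] linear_maps_add[OF g])
qed

lemma tensor_map_facts:
  assumes U: "module k U" and V: "module k V" and M: "module k M" and N: "module k N"
    and f: "f \<in> linear_maps k U M" and g: "g \<in> linear_maps k V N"
  shows tensor_map_linear: "tensor_map k M N f g \<in> linear_maps k (tensor_product k U V) (tensor_product k M N)"
    and tensor_map_pure: "u \<in> carrier U \<Longrightarrow> v \<in> carrier V \<Longrightarrow>
      tensor_map k M N f g (pure_tensor k U V u v) = pure_tensor k M N (f u) (g v)"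
proof -
  note T = tensor_product_module[OF M N]
  note b = bilinear_map_comp[OF pure_tensor_bilinear[OF M N] f g]
  show "tensor_map k M N f g \<in> linear_maps k (tensor_product k U V) (tensor_product k M N)"
    unfolding tensor_map_def by (rule tensor_lift_linear[OF U V T b])
  show "u \<in> carrier U \<Longrightarrow> v \<in> carrier V \<Longrightarrow>
      tensor_map k M N f g (pure_tensor k U V u v) = pure_tensor k M N (f u) (g v)"
    unfolding tensor_map_def by (rule tensor_lift_pure[OF U V T b])
qed

text \<open>
  This is what makes the nested lift in \<open>tensor_assoc\<close> legitimate. Linearity in \<open>z\<close> is not part of
  the universal property of \<open>L \<otimes> M\<close>; it is inherited from pure tensors by induction on \<open>t\<close>.
\<close>
lemma trilinear_lift:
  assumes L: "module k L" and M: "module k M" and N: "module k N" and P: "module k P"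
    and b: "\<And>z. z \<in> carrier N \<Longrightarrow> bilinear_map k L M P (b z)"
    and lin: "\<And>x y. x \<in> carrier L \<Longrightarrow> y \<in> carrier M \<Longrightarrow> (\<lambda>z. b z x y) \<in> linear_maps k N P"
  shows "bilinear_map k (tensor_product k L M) N P (\<lambda>t z. tensor_lift k P (b z) t)"
  unfolding bilinear_map_def
proof (intro conjI ballI)
  fix z assume z: "z \<in> carrier N"
  show "tensor_lift k P (b z) \<in> linear_maps k (tensor_product k L M) P"
    by (rule tensor_lift_linear[OF L M P b[OF z]])
next
  interpret N: module k N by fact
  interpret P: module k P by fact
  note T = tensor_product_module[OF L M]
  note lift = tensor_lift_linear[OF L M P b] and pure = tensor_lift_pure[OF L M P b]
  fix t assume "t \<in> carrier (tensor_product k L M)"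
  with L M show "(\<lambda>z. tensor_lift k P (b z) t) \<in> linear_maps k N P"
  proof (induction rule: tensor_induct)
    case zero
    show ?case
      by (rule linear_mapsI) (simp_all add: linear_maps_zero[OF T P lift])
  next
    case (step x y t)
    have eq: "tensor_lift k P (b z) (pure_tensor k L M x y \<oplus>\<^bsub>tensor_product k L M\<^esub> t)
        = b z x y \<oplus>\<^bsub>P\<^esub> tensor_lift k P (b z) t" if "z \<in> carrier N" for z
      using step that pure_tensor_closed[OF L M] by (simp add: linear_maps_add[OF lift] pure)
    note closed = linear_maps_closed[OF lin] linear_maps_closed[OF step.IH]
    show ?case
      by (rule linear_mapsI)
        (use step in \<open>simp_all add: eq closed linear_maps_add[OF lin] linear_maps_add[OF step.IH]
          linear_maps_smult[OF lin] linear_maps_smult[OF step.IH] P.a_ac P.smult_r_distr\<close>)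
  qed
qed

lemma tensor_assoc_facts:
  assumes L: "module k L" and M: "module k M" and N: "module k N"
  shows tensor_assoc_linear: "tensor_assoc k L M N \<in> linear_maps k
      (tensor_product k (tensor_product k L M) N) (tensor_product k L (tensor_product k M N))"
    and tensor_assoc_pure_pure: "x \<in> carrier L \<Longrightarrow> y \<in> carrier M \<Longrightarrow> z \<in> carrier N \<Longrightarrow>
      tensor_assoc k L M N (pure_tensor k (tensor_product k L M) N (pure_tensor k L M x y) z)
      = pure_tensor k L (tensor_product k M N) x (pure_tensor k M N y z)"
proof -
  note MN = tensor_product_module[OF M N]
  note P = tensor_product_module[OF L MN]
  note p = pure_tensor_bilinear[OF M N] and q = pure_tensor_bilinear[OF L MN]
  let ?b = "\<lambda>z x y. pure_tensor k L (tensor_product k M N) x (pure_tensor k M N y z)"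
  have id: "(\<lambda>x. x) \<in> linear_maps k L L" by (rule linear_mapsI) simp_all
  have b: "bilinear_map k L M (tensor_product k L (tensor_product k M N)) (?b z)"
    if "z \<in> carrier N" for z
    using p that by (intro bilinear_map_comp[OF q id]) (simp add: bilinear_map_def)
  have lin: "(\<lambda>z. ?b z x y) \<in> linear_maps k N (tensor_product k L (tensor_product k M N))"
    if "x \<in> carrier L" "y \<in> carrier M" for x y
  proof -
    have "pure_tensor k M N y \<in> linear_maps k N (tensor_product k M N)"
      using p that by (simp add: bilinear_map_def)
    moreover have "pure_tensor k L (tensor_product k M N) x
        \<in> linear_maps k (tensor_product k M N) (tensor_product k L (tensor_product k M N))"
      using q that by (simp add: bilinear_map_def)
    ultimately show ?thesis by (rule linear_maps_comp)
  qed
  note tri = trilinear_lift[OF L M N P b lin]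
  note LM = tensor_product_module[OF L M]
  show "tensor_assoc k L M N \<in> linear_maps k
      (tensor_product k (tensor_product k L M) N) (tensor_product k L (tensor_product k M N))"
    unfolding tensor_assoc_def Let_def by (rule tensor_lift_linear[OF LM N P tri])
  have outer: "tensor_assoc k L M N (pure_tensor k (tensor_product k L M) N t z)
      = tensor_lift k (tensor_product k L (tensor_product k M N)) (?b z) t"
    if "t \<in> carrier (tensor_product k L M)" "z \<in> carrier N" for t z
    unfolding tensor_assoc_def Let_def by (rule tensor_lift_pure[OF LM N P tri that])
  show "tensor_assoc k L M N (pure_tensor k (tensor_product k L M) N (pure_tensor k L M x y) z)
      = pure_tensor k L (tensor_product k M N) x (pure_tensor k M N y z)"
    if "x \<in> carrier L" "y \<in> carrier M" "z \<in> carrier N" for x y z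
    using that by (simp add: outer pure_tensor_closed[OF L M] tensor_lift_pure[OF L M P b])
qed

section \<open>Linear functionals over a field\<close>

lemma submodule_add_line:
  assumes M: "module k M" and H: "submodule H k M" and x: "x \<in> carrier M"
  shows "submodule {h \<oplus>\<^bsub>M\<^esub> c \<odot>\<^bsub>M\<^esub> x | h c. h \<in> H \<and> c \<in> carrier k} k M" (is "submodule ?L k M")
    and "H \<subseteq> {h \<oplus>\<^bsub>M\<^esub> c \<odot>\<^bsub>M\<^esub> x | h c. h \<in> H \<and> c \<in> carrier k}"
    and "x \<in> {h \<oplus>\<^bsub>M\<^esub> c \<odot>\<^bsub>M\<^esub> x | h c. h \<in> H \<and> c \<in> carrier k}"
proof -
  interpret M: module k M by fact
  note carr = submodule_carrier[OF H]
  show *: "H \<subseteq> ?L"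
  proof
    fix h assume h: "h \<in> H"
    then have "h = h \<oplus>\<^bsub>M\<^esub> \<zero>\<^bsub>k\<^esub> \<odot>\<^bsub>M\<^esub> x" using carr x by simp
    then show "h \<in> ?L" using h by blast
  qed
  have "x = \<zero>\<^bsub>M\<^esub> \<oplus>\<^bsub>M\<^esub> \<one>\<^bsub>k\<^esub> \<odot>\<^bsub>M\<^esub> x" using x by simp
  then show "x \<in> ?L" using submodule_zero[OF H] by blast
  show "submodule ?L k M"
  proof (rule submodule_closedI[OF M])
    show "?L \<subseteq> carrier M" using carr x by auto
    show "\<zero>\<^bsub>M\<^esub> \<in> ?L" using submodule_zero[OF H] * by blast
  next
    fix u v assume "u \<in> ?L" "v \<in> ?L"
    then obtain h c h' c' where u: "h \<in> H" "c \<in> carrier k" "u = h \<oplus>\<^bsub>M\<^esub> c \<odot>\<^bsub>M\<^esub> x"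
      and v: "h' \<in> H" "c' \<in> carrier k" "v = h' \<oplus>\<^bsub>M\<^esub> c' \<odot>\<^bsub>M\<^esub> x" by blast
    then have "u \<oplus>\<^bsub>M\<^esub> v = (h \<oplus>\<^bsub>M\<^esub> h') \<oplus>\<^bsub>M\<^esub> (c \<oplus>\<^bsub>k\<^esub> c') \<odot>\<^bsub>M\<^esub> x"
      using carr x by (simp add: M.smult_l_distr M.a_ac)
    then show "u \<oplus>\<^bsub>M\<^esub> v \<in> ?L" using submodule_add[OF H u(1) v(1)] u v by blast
  next
    fix d u assume d: "d \<in> carrier k" and "u \<in> ?L"
    then obtain h c where u: "h \<in> H" "c \<in> carrier k" "u = h \<oplus>\<^bsub>M\<^esub> c \<odot>\<^bsub>M\<^esub> x" by blast
    then have "d \<odot>\<^bsub>M\<^esub> u = d \<odot>\<^bsub>M\<^esub> h \<oplus>\<^bsub>M\<^esub> (d \<otimes>\<^bsub>k\<^esub> c) \<odot>\<^bsub>M\<^esub> x"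
      using carr x d by (simp add: M.smult_r_distr M.smult_assoc1)
    then show "d \<odot>\<^bsub>M\<^esub> u \<in> ?L" using submodule_smult[OF H d u(1)] u d by blast
  qed
qed

text \<open>
  Zorn's lemma applies because membership of \<open>a\<close> in the union of a chain is decided in one of its
  members.
\<close>
lemma exists_maximal_submodule_avoiding:
  assumes M: "module k M" and W: "submodule W k M" and a: "a \<notin> W"
  obtains H where "submodule H k M" "W \<subseteq> H" "a \<notin> H"
    "\<And>H'. submodule H' k M \<Longrightarrow> H \<subseteq> H' \<Longrightarrow> a \<notin> H' \<Longrightarrow> H' = H"
proof -
  define \<A> where "\<A> = {H. submodule H k M \<and> W \<subseteq> H \<and> a \<notin> H}"
  have "\<exists>H\<in>\<A>. \<forall>X\<in>\<A>. H \<subseteq> X \<longrightarrow> X = H"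
  proof (rule subset_Zorn_nonempty)
    show "\<A> \<noteq> {}" using assms by (auto simp: \<A>_def)
  next
    fix \<C> assume ne: "\<C> \<noteq> {}" and chain: "subset.chain \<A> \<C>"
    have sub: "submodule X k M" if "X \<in> \<C>" for X
      using chain that by (auto simp: subset.chain_def \<A>_def)
    have "submodule (\<Union>\<C>) k M"
    proof (rule submodule_closedI[OF M])
      show "\<Union>\<C> \<subseteq> carrier M" using submodule_subset[OF sub] by blast
      show "\<zero>\<^bsub>M\<^esub> \<in> \<Union>\<C>" using ne submodule_zero[OF sub] by blast
    next
      fix x y assume "x \<in> \<Union>\<C>" "y \<in> \<Union>\<C>"
      then obtain X Y where XY: "X \<in> \<C>" "Y \<in> \<C>" "x \<in> X" "y \<in> Y" by blast
      then have "X \<subseteq> Y \<or> Y \<subseteq> X" using chain by (auto simp: subset.chain_def)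
      then obtain Z where "Z \<in> \<C>" "x \<in> Z" "y \<in> Z" using XY by blast
      then show "x \<oplus>\<^bsub>M\<^esub> y \<in> \<Union>\<C>" using submodule_add[OF sub] by blast
    next
      fix c x assume "c \<in> carrier k" "x \<in> \<Union>\<C>"
      then show "c \<odot>\<^bsub>M\<^esub> x \<in> \<Union>\<C>" using submodule_smult[OF sub] by blast
    qed
    moreover have "W \<subseteq> X" "a \<notin> X" if "X \<in> \<C>" for X
      using that chain by (auto simp: subset.chain_def \<A>_def)
    then have "W \<subseteq> \<Union>\<C>" "a \<notin> \<Union>\<C>" using ne by blast+
    ultimately show "\<Union>\<C> \<in> \<A>" by (simp add: \<A>_def)
  qed
  then obtain H where "H \<in> \<A>" "\<And>X. X \<in> \<A> \<Longrightarrow> H \<subseteq> X \<Longrightarrow> X = H" by blast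
  then show thesis by (intro that[of H]) (auto simp: \<A>_def)
qed

text \<open>
  A submodule \<open>H\<close> that is maximal among those not containing \<open>a\<close> has codimension one: adjoining any
  \<open>x \<notin> H\<close> brings in \<open>a\<close>, and over a field this can be solved for \<open>x\<close>, so that every vector is uniquely
  \<open>h + c a\<close>. The functional reads off the coefficient \<open>c\<close>.
\<close>
lemma exists_linear_functional:
  assumes k: "field k" and M: "module k M" and W: "submodule W k M"
    and a: "a \<in> carrier M" "a \<notin> W"
  obtains f where "f \<in> linear_maps k M (self_module k)" "\<And>w. w \<in> W \<Longrightarrow> f w = \<zero>\<^bsub>k\<^esub>" "f a = \<one>\<^bsub>k\<^esub>"
proof -
  interpret k: field k by fact
  interpret M: module k M by fact
  obtain H where H: "submodule H k M" and WH: "W \<subseteq> H" and aH: "a \<notin> H"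
    and max: "\<And>H'. submodule H' k M \<Longrightarrow> H \<subseteq> H' \<Longrightarrow> a \<notin> H' \<Longrightarrow> H' = H"
    using exists_maximal_submodule_avoiding[OF M W a(2)] by blast
  note carr = submodule_carrier[OF H]
  note neg = M.submoduleE(3)[OF H]
  \<comment> \<open>Uniqueness of coefficients will follow from this, as a difference of two would scale \<open>a\<close> into \<open>H\<close>.\<close>
  have aH_scaled: "c = \<zero>\<^bsub>k\<^esub>" if "c \<in> carrier k" "c \<odot>\<^bsub>M\<^esub> a \<in> H" for c
  proof (rule ccontr)
    assume "c \<noteq> \<zero>\<^bsub>k\<^esub>"
    then have inv: "c \<in> Units k" using that k.field_Units by simp
    then have "inv\<^bsub>k\<^esub> c \<odot>\<^bsub>M\<^esub> (c \<odot>\<^bsub>M\<^esub> a) = a"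
      using that a by (simp add: M.smult_assoc1[symmetric])
    then show False using aH submodule_smult[OF H k.Units_inv_closed[OF inv] that(2)] by simp
  qed
  have ex: "\<exists>h c. h \<in> H \<and> c \<in> carrier k \<and> x = h \<oplus>\<^bsub>M\<^esub> c \<odot>\<^bsub>M\<^esub> a" if x: "x \<in> carrier M" for x
  proof (cases "x \<in> H")
    case True
    then show ?thesis using a x by (intro exI[of _ x] exI[of _ "\<zero>\<^bsub>k\<^esub>"]) simp
  next
    case False
    let ?L = "{h \<oplus>\<^bsub>M\<^esub> c \<odot>\<^bsub>M\<^esub> x | h c. h \<in> H \<and> c \<in> carrier k}"
    have "a \<in> ?L"
    proof (rule ccontr)
      assume "a \<notin> ?L"
      then have "?L = H"
        by (rule max[OF submodule_add_line(1,2)[OF M H x]])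
      then show False using submodule_add_line(3)[OF M H x] False by simp
    qed
    then obtain h c where hc: "h \<in> H" "c \<in> carrier k" "a = h \<oplus>\<^bsub>M\<^esub> c \<odot>\<^bsub>M\<^esub> x" by blast
    have "c \<noteq> \<zero>\<^bsub>k\<^esub>"
    proof
      assume "c = \<zero>\<^bsub>k\<^esub>"
      then have "a = h" using hc x carr by simp
      then show False using hc aH by simp
    qed
    then have inv: "c \<in> Units k" using hc k.field_Units by simp
    let ?d = "inv\<^bsub>k\<^esub> c"
    have d: "?d \<in> carrier k" using inv by simp
    have "?d \<odot>\<^bsub>M\<^esub> a = ?d \<odot>\<^bsub>M\<^esub> h \<oplus>\<^bsub>M\<^esub> ?d \<odot>\<^bsub>M\<^esub> (c \<odot>\<^bsub>M\<^esub> x)"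
      using hc d carr x by (simp add: M.smult_r_distr)
    also have "?d \<odot>\<^bsub>M\<^esub> (c \<odot>\<^bsub>M\<^esub> x) = x"
      using hc d x inv by (simp add: M.smult_assoc1[symmetric])
    finally have "\<ominus>\<^bsub>M\<^esub> (?d \<odot>\<^bsub>M\<^esub> h) \<oplus>\<^bsub>M\<^esub> ?d \<odot>\<^bsub>M\<^esub> a = x"
      using d hc(1) carr x by (simp add: M.a_assoc[symmetric] M.l_neg)
    moreover have "\<ominus>\<^bsub>M\<^esub> (?d \<odot>\<^bsub>M\<^esub> h) \<in> H"
      using d hc(1) by (intro neg submodule_smult[OF H])
    ultimately show ?thesis using d by blast
  qed
  have unique: "c = d" if "h \<in> H" "h' \<in> H" "c \<in> carrier k" "d \<in> carrier k"
    "h \<oplus>\<^bsub>M\<^esub> c \<odot>\<^bsub>M\<^esub> a = h' \<oplus>\<^bsub>M\<^esub> d \<odot>\<^bsub>M\<^esub> a" for h h' c d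
  proof -
    have "(c \<oplus>\<^bsub>k\<^esub> \<ominus>\<^bsub>k\<^esub> d) \<odot>\<^bsub>M\<^esub> a = c \<odot>\<^bsub>M\<^esub> a \<oplus>\<^bsub>M\<^esub> \<ominus>\<^bsub>M\<^esub> (d \<odot>\<^bsub>M\<^esub> a)"
      using that a by (simp add: M.smult_l_distr M.smult_l_minus)
    also have "\<dots> = \<ominus>\<^bsub>M\<^esub> h \<oplus>\<^bsub>M\<^esub> (h \<oplus>\<^bsub>M\<^esub> c \<odot>\<^bsub>M\<^esub> a) \<oplus>\<^bsub>M\<^esub> \<ominus>\<^bsub>M\<^esub> (d \<odot>\<^bsub>M\<^esub> a)"
      using that(1,3,4) a carr by (simp add: M.a_assoc[symmetric] M.l_neg)
    also have "\<dots> = \<ominus>\<^bsub>M\<^esub> h \<oplus>\<^bsub>M\<^esub> (h' \<oplus>\<^bsub>M\<^esub> d \<odot>\<^bsub>M\<^esub> a) \<oplus>\<^bsub>M\<^esub> \<ominus>\<^bsub>M\<^esub> (d \<odot>\<^bsub>M\<^esub> a)"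
      using that(5) by simp
    also have "\<dots> = \<ominus>\<^bsub>M\<^esub> h \<oplus>\<^bsub>M\<^esub> h'"
      using that(1,2,4) a carr by (simp add: M.a_assoc M.r_neg)
    finally have "(c \<oplus>\<^bsub>k\<^esub> \<ominus>\<^bsub>k\<^esub> d) \<odot>\<^bsub>M\<^esub> a \<in> H"
      using that neg submodule_add[OF H] by simp
    then have "c \<oplus>\<^bsub>k\<^esub> \<ominus>\<^bsub>k\<^esub> d = \<zero>\<^bsub>k\<^esub>" using that by (intro aH_scaled) simp_all
    then show "c = d" using that k.r_right_minus_eq by (simp add: a_minus_def)
  qed
  define f where "f x = (THE c. c \<in> carrier k \<and> (\<exists>h\<in>H. x = h \<oplus>\<^bsub>M\<^esub> c \<odot>\<^bsub>M\<^esub> a))" for x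
  have f_eq: "f (h \<oplus>\<^bsub>M\<^esub> c \<odot>\<^bsub>M\<^esub> a) = c" if "h \<in> H" "c \<in> carrier k" for h c
    unfolding f_def using that unique by (intro the_equality) blast+
  have "f \<in> linear_maps k M (self_module k)"
  proof (rule linear_mapsI)
    fix x assume "x \<in> carrier M"
    then obtain h c where x: "h \<in> H" "c \<in> carrier k" "x = h \<oplus>\<^bsub>M\<^esub> c \<odot>\<^bsub>M\<^esub> a" using ex by blast
    then show "f x \<in> carrier (self_module k)" by (simp add: f_eq self_module_def)
    fix y assume "y \<in> carrier M"
    then obtain h' d where y: "h' \<in> H" "d \<in> carrier k" "y = h' \<oplus>\<^bsub>M\<^esub> d \<odot>\<^bsub>M\<^esub> a" using ex by blast
    have "x \<oplus>\<^bsub>M\<^esub> y = (h \<oplus>\<^bsub>M\<^esub> h') \<oplus>\<^bsub>M\<^esub> (c \<oplus>\<^bsub>k\<^esub> d) \<odot>\<^bsub>M\<^esub> a"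
      using x y carr a by (simp add: M.smult_l_distr M.a_ac)
    then have "f (x \<oplus>\<^bsub>M\<^esub> y) = c \<oplus>\<^bsub>k\<^esub> d"
      using f_eq[OF submodule_add[OF H x(1) y(1)]] x y by simp
    then show "f (x \<oplus>\<^bsub>M\<^esub> y) = f x \<oplus>\<^bsub>self_module k\<^esub> f y"
      using x y by (simp add: f_eq self_module_def)
  next
    fix d x assume d: "d \<in> carrier k" and "x \<in> carrier M"
    then obtain h c where x: "h \<in> H" "c \<in> carrier k" "x = h \<oplus>\<^bsub>M\<^esub> c \<odot>\<^bsub>M\<^esub> a" using ex by blast
    have "d \<odot>\<^bsub>M\<^esub> x = d \<odot>\<^bsub>M\<^esub> h \<oplus>\<^bsub>M\<^esub> (d \<otimes>\<^bsub>k\<^esub> c) \<odot>\<^bsub>M\<^esub> a"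
      using x d carr a by (simp add: M.smult_r_distr M.smult_assoc1)
    then have "f (d \<odot>\<^bsub>M\<^esub> x) = d \<otimes>\<^bsub>k\<^esub> c"
      using f_eq[OF submodule_smult[OF H d x(1)]] x d by simp
    then show "f (d \<odot>\<^bsub>M\<^esub> x) = d \<odot>\<^bsub>self_module k\<^esub> f x"
      using x by (simp add: f_eq self_module_def)
  qed
  moreover have "f w = \<zero>\<^bsub>k\<^esub>" if "w \<in> W" for w
  proof -
    have "w \<in> H" using that WH by blast
    then show ?thesis using f_eq[of w "\<zero>\<^bsub>k\<^esub>"] carr a by simp
  qed
  moreover have "f a = \<one>\<^bsub>k\<^esub>"
    using f_eq[OF submodule_zero[OF H], of "\<one>\<^bsub>k\<^esub>"] a by simp
  ultimately show thesis by (rule that)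
qed


section \<open>Slices of tensors\<close>

text \<open>
  The map \<open>f \<otimes> id\<close> from \<open>M \<otimes> N\<close> to \<open>k \<otimes> N = N\<close>.
\<close>
definition slice ::
    "('k, 'r) ring_scheme \<Rightarrow> ('k, 'n, 'y) module_scheme \<Rightarrow> ('m \<Rightarrow> 'k) \<Rightarrow> ('k, 'm, 'n) tensor \<Rightarrow> 'n"
  where "slice k N f = tensor_lift k N (\<lambda>x y. f x \<odot>\<^bsub>N\<^esub> y)"

lemma slice_facts:
  assumes M: "module k M" and N: "module k N" and f: "f \<in> linear_maps k M (self_module k)"
  shows slice_linear: "slice k N f \<in> linear_maps k (tensor_product k M N) N"
    and slice_pure: "x \<in> carrier M \<Longrightarrow> y \<in> carrier N \<Longrightarrow>
      slice k N f (pure_tensor k M N x y) = f x \<odot>\<^bsub>N\<^esub> y"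
  unfolding slice_def
  using tensor_lift_linear[OF M N N bilinear_smult_left[OF N f]]
    tensor_lift_pure[OF M N N bilinear_smult_left[OF N f]] by simp_all

text \<open>
  Tensors are represented by lists of pairs, since the slice criterion is proved by induction on the
  number of pure tensors in a representation.
\<close>
definition pure_sum ::
    "('k, 'r) ring_scheme \<Rightarrow> ('k, 'm, 'x) module_scheme \<Rightarrow> ('k, 'n, 'y) module_scheme
      \<Rightarrow> ('m \<times> 'n) list \<Rightarrow> ('k, 'm, 'n) tensor"
  where "pure_sum k M N zs =
    foldr (\<lambda>(x, y) t. pure_tensor k M N x y \<oplus>\<^bsub>tensor_product k M N\<^esub> t) zs \<zero>\<^bsub>tensor_product k M N\<^esub>"

lemma pure_sum_simps [simp]:
  "pure_sum k M N [] = \<zero>\<^bsub>tensor_product k M N\<^esub>"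
  "pure_sum k M N ((x, y) # zs) = pure_tensor k M N x y \<oplus>\<^bsub>tensor_product k M N\<^esub> pure_sum k M N zs"
  by (simp_all add: pure_sum_def)

lemma pure_sum_closed:
  assumes M: "module k M" and N: "module k N" and "set zs \<subseteq> carrier M \<times> carrier N"
  shows "pure_sum k M N zs \<in> carrier (tensor_product k M N)"
proof -
  interpret T: module k "tensor_product k M N" by (rule tensor_product_module[OF M N])
  show ?thesis
    using assms(3) by (induction zs) (auto simp: pure_tensor_closed[OF M N])
qed

lemma tensor_eq_pure_sum:
  assumes M: "module k M" and N: "module k N" and t: "t \<in> carrier (tensor_product k M N)"
  obtains zs where "set zs \<subseteq> carrier M \<times> carrier N" "t = pure_sum k M N zs"
proof -
  have "\<exists>zs. set zs \<subseteq> carrier M \<times> carrier N \<and> t = pure_sum k M N zs"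
    using M N t
  proof (induction rule: tensor_induct)
    case zero
    show ?case by (rule exI[of _ "[]"]) simp
  next
    case (step x y t)
    then obtain zs where "set zs \<subseteq> carrier M \<times> carrier N" "t = pure_sum k M N zs" by blast
    then show ?case using step by (intro exI[of _ "(x, y) # zs"]) simp
  qed
  then show thesis using that by blast
qed

lemma linear_map_pure_sum:
  assumes U: "module k U" and V: "module k V" and M: "module k M" and N: "module k N"
    and F: "F \<in> linear_maps k (tensor_product k U V) (tensor_product k M N)"
    and pure: "\<And>x y. x \<in> carrier U \<Longrightarrow> y \<in> carrier V \<Longrightarrow>
      F (pure_tensor k U V x y) = case_prod (pure_tensor k M N) (p (x, y))"
    and "set zs \<subseteq> carrier U \<times> carrier V"
  shows "F (pure_sum k U V zs) = pure_sum k M N (map p zs)"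
  using assms(7)
proof (induction zs)
  case Nil
  show ?case
    using linear_maps_zero[OF tensor_product_module[OF U V] tensor_product_module[OF M N] F] by simp
next
  case (Cons z zs)
  obtain x y where z: "z = (x, y)" by (cases z)
  obtain x' y' where p: "p (x, y) = (x', y')" by (cases "p (x, y)")
  show ?case
    using Cons pure[of x y] pure_tensor_closed[OF U V] pure_sum_closed[OF U V]
    by (simp add: z p linear_maps_add[OF F])
qed

text \<open>
  The recursion over the list matches the one in \<open>pure_sum\<close>, so that a vector in the span of the left
  factors of a sum of pure tensors can be distributed over the summands.
\<close>
fun lin_span :: "('k, 'r) ring_scheme \<Rightarrow> ('k, 'm, 'x) module_scheme \<Rightarrow> 'm list \<Rightarrow> 'm set"
  where
    "lin_span k M [] = {\<zero>\<^bsub>M\<^esub>}"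
  | "lin_span k M (x # xs) = {h \<oplus>\<^bsub>M\<^esub> c \<odot>\<^bsub>M\<^esub> x | h c. h \<in> lin_span k M xs \<and> c \<in> carrier k}"

lemma lin_span_facts:
  assumes M: "module k M" and "set xs \<subseteq> carrier M"
  shows lin_span_submodule: "submodule (lin_span k M xs) k M"
    and lin_span_superset: "set xs \<subseteq> lin_span k M xs"
proof -
  have "submodule (lin_span k M xs) k M \<and> set xs \<subseteq> lin_span k M xs"
    using assms(2)
  proof (induction xs)
    case Nil
    show ?case using submodule_trivial[OF M] by simp
  next
    case (Cons x xs)
    then have sub: "submodule (lin_span k M xs) k M" and sup: "set xs \<subseteq> lin_span k M xs"
      and x: "x \<in> carrier M" by auto
    show ?case
      using submodule_add_line[OF M sub x] sup by (simp only: lin_span.simps list.set) blast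
  qed
  then show "submodule (lin_span k M xs) k M" "set xs \<subseteq> lin_span k M xs" by auto
qed

text \<open>
  If \<open>a\<close> is the combination \<open>c\<^sub>1 x\<^sub>1 + \<dots> + c\<^sub>n x\<^sub>n\<close>, then
  \<open>a \<otimes> y + x\<^sub>1 \<otimes> y\<^sub>1 + \<dots> + x\<^sub>n \<otimes> y\<^sub>n = x\<^sub>1 \<otimes> (c\<^sub>1 y + y\<^sub>1) + \<dots> + x\<^sub>n \<otimes> (c\<^sub>n y + y\<^sub>n)\<close>.
\<close>
lemma pure_sum_absorb:
  assumes M: "module k M" and N: "module k N" and y: "y \<in> carrier N"
    and "a \<in> lin_span k M (map fst zs)" "set zs \<subseteq> carrier M \<times> carrier N"
  shows "\<exists>zs'. length zs' = length zs \<and> set zs' \<subseteq> carrier M \<times> carrier N \<and>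
    pure_tensor k M N a y \<oplus>\<^bsub>tensor_product k M N\<^esub> pure_sum k M N zs = pure_sum k M N zs'"
  using assms(4,5)
proof (induction zs arbitrary: a)
  case Nil
  interpret M: module k M by fact
  interpret T: module k "tensor_product k M N" by (rule tensor_product_module[OF M N])
  have "pure_tensor k M N (\<zero>\<^bsub>k\<^esub> \<odot>\<^bsub>M\<^esub> \<zero>\<^bsub>M\<^esub>) y = \<zero>\<^bsub>tensor_product k M N\<^esub>"
    using y pure_tensor_closed[OF M N]
    by (subst bilinear_map_smult_left[OF pure_tensor_bilinear[OF M N]]) simp_all
  then show ?case using Nil by simp
next
  case (Cons z zs)
  interpret M: module k M by fact
  interpret N: module k N by fact
  interpret T: module k "tensor_product k M N" by (rule tensor_product_module[OF M N])
  note bil = pure_tensor_bilinear[OF M N]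
  obtain x b where z: "z = (x, b)" by (cases z)
  have xb: "x \<in> carrier M" "b \<in> carrier N" "set zs \<subseteq> carrier M \<times> carrier N"
    using Cons.prems z by auto
  obtain w c where w: "w \<in> lin_span k M (map fst zs)" "c \<in> carrier k" "a = w \<oplus>\<^bsub>M\<^esub> c \<odot>\<^bsub>M\<^esub> x"
    using Cons.prems z by auto
  have "submodule (lin_span k M (map fst zs)) k M"
    using xb by (intro lin_span_submodule[OF M]) auto
  then have wM: "w \<in> carrier M" using w submodule_carrier by metis
  obtain zs' where zs': "length zs' = length zs" "set zs' \<subseteq> carrier M \<times> carrier N"
    "pure_tensor k M N w y \<oplus>\<^bsub>tensor_product k M N\<^esub> pure_sum k M N zs = pure_sum k M N zs'"
    using Cons.IH[OF w(1) xb(3)] by blast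
  have "pure_tensor k M N a y = pure_tensor k M N w y \<oplus>\<^bsub>tensor_product k M N\<^esub>
      pure_tensor k M N x (c \<odot>\<^bsub>N\<^esub> y)"
    using w wM xb y
    by (simp add: bilinear_map_add_left[OF bil] bilinear_map_smult_left[OF bil] bilinear_map_smult_right[OF bil])
  then have "pure_tensor k M N a y \<oplus>\<^bsub>tensor_product k M N\<^esub> pure_sum k M N (z # zs)
      = pure_tensor k M N x (c \<odot>\<^bsub>N\<^esub> y \<oplus>\<^bsub>N\<^esub> b) \<oplus>\<^bsub>tensor_product k M N\<^esub>
        (pure_tensor k M N w y \<oplus>\<^bsub>tensor_product k M N\<^esub> pure_sum k M N zs)"
    using w wM xb y pure_tensor_closed[OF M N] pure_sum_closed[OF M N xb(3)]
    by (simp add: z bilinear_map_add_right[OF bil] T.a_ac)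
  also have "\<dots> = pure_sum k M N ((x, c \<odot>\<^bsub>N\<^esub> y \<oplus>\<^bsub>N\<^esub> b) # zs')" using zs' by simp
  finally show ?case
    using zs' w xb y by (intro exI[of _ "(x, c \<odot>\<^bsub>N\<^esub> y \<oplus>\<^bsub>N\<^esub> b) # zs'"]) simp
qed

lemma slice_pure_sum_zero:
  assumes M: "module k M" and N: "module k N" and f: "f \<in> linear_maps k M (self_module k)"
    and "\<And>x. x \<in> fst ` set zs \<Longrightarrow> f x = \<zero>\<^bsub>k\<^esub>" "set zs \<subseteq> carrier M \<times> carrier N"
  shows "slice k N f (pure_sum k M N zs) = \<zero>\<^bsub>N\<^esub>"
  using assms(4,5)
proof (induction zs)
  case Nil
  show ?case using linear_maps_zero[OF tensor_product_module[OF M N] N slice_linear[OF M N f]] by simp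
next
  case (Cons z zs)
  interpret N: module k N by fact
  obtain x y where "z = (x, y)" by (cases z)
  then show ?case
    using Cons pure_tensor_closed[OF M N] pure_sum_closed[OF M N]
    by (simp add: linear_maps_add[OF slice_linear[OF M N f]] slice_pure[OF M N f])
qed

lemma submodule_image:
  assumes M: "module k M" and N: "module k N" and f: "f \<in> linear_maps k M N" and H: "submodule H k M"
  shows "submodule (f ` H) k N"
proof (rule submodule_closedI[OF N])
  note carr = submodule_carrier[OF H]
  show "f ` H \<subseteq> carrier N" using carr linear_maps_closed[OF f] by auto
  show "\<zero>\<^bsub>N\<^esub> \<in> f ` H"
    using linear_maps_zero[OF M N f] submodule_zero[OF H] by (metis imageI)
  show "a \<oplus>\<^bsub>N\<^esub> b \<in> f ` H" if "a \<in> f ` H" "b \<in> f ` H" for a b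
    using that by (auto simp: carr linear_maps_add[OF f, symmetric] submodule_add[OF H])
  show "c \<odot>\<^bsub>N\<^esub> x \<in> f ` H" if "c \<in> carrier k" "x \<in> f ` H" for c x
    using that by (auto simp: carr linear_maps_smult[OF f, symmetric] submodule_smult[OF H])
qed

text \<open>
  The slice criterion. Only functionals on \<open>U\<close> that come from \<open>M\<close> are used: the induction needs
  functionals that separate \<open>a \<in> U\<close> from a subspace of \<open>U\<close>, and since \<open>i\<close> is injective these can be
  found on \<open>M\<close>. In this form the criterion yields injectivity of tensor maps without extending
  functionals from \<open>U\<close> to \<open>M\<close>.
\<close>
lemma pure_sum_of_slices:
  assumes k: "field k" and U: "module k U" and V: "module k V" and M: "module k M"
    and i: "i \<in> linear_maps k U M" "inj_on i (carrier U)" and Y: "submodule Y k V"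
    and t: "t \<in> carrier (tensor_product k U V)"
    and slices: "\<And>f. f \<in> linear_maps k M (self_module k) \<Longrightarrow> slice k V (\<lambda>x. f (i x)) t \<in> Y"
  shows "\<exists>zs. set zs \<subseteq> carrier U \<times> Y \<and> t = pure_sum k U V zs"
proof -
  interpret V: module k V by fact
  note fi = linear_maps_comp[OF i(1)]
  have "\<exists>zs'. set zs' \<subseteq> carrier U \<times> Y \<and> pure_sum k U V zs = pure_sum k U V zs'"
    if "set zs \<subseteq> carrier U \<times> carrier V"
      "\<And>f. f \<in> linear_maps k M (self_module k) \<Longrightarrow> slice k V (\<lambda>x. f (i x)) (pure_sum k U V zs) \<in> Y"
    for zs
    using that
  proof (induction "length zs" arbitrary: zs)
    case 0
    then show ?case by (intro exI[of _ "[]"]) simp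
  next
    case (Suc n)
    obtain a b ws where zs: "zs = (a, b) # ws" and n: "n = length ws"
      using Suc.hyps(2) by (cases zs) auto
    have ab: "a \<in> carrier U" "b \<in> carrier V" and ws: "set ws \<subseteq> carrier U \<times> carrier V"
      using Suc.prems(1) zs by auto
    let ?W = "lin_span k U (map fst ws)"
    have fst_ws: "set (map fst ws) \<subseteq> carrier U" using ws by auto
    have W: "submodule ?W k U" by (rule lin_span_submodule[OF U fst_ws])
    show ?case
    proof (cases "a \<in> ?W")
      case True
      obtain zs' where "length zs' = length ws" "set zs' \<subseteq> carrier U \<times> carrier V"
        "pure_sum k U V zs = pure_sum k U V zs'"
        using pure_sum_absorb[OF U V ab(2) True ws] zs by auto
      then show ?thesis using Suc.hyps(1)[of zs'] n Suc.prems(2) by simp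
    next
      case False
      then have "i a \<notin> i ` ?W"
        using i(2) ab(1) submodule_subset[OF W] by (simp add: inj_on_image_mem_iff)
      then obtain f where f: "f \<in> linear_maps k M (self_module k)"
        and f0: "\<And>w. w \<in> i ` ?W \<Longrightarrow> f w = \<zero>\<^bsub>k\<^esub>" and f1: "f (i a) = \<one>\<^bsub>k\<^esub>"
        by (rule exists_linear_functional[OF k M submodule_image[OF U M i(1) W]
              linear_maps_closed[OF i(1) ab(1)]]) (rule that)
      \<comment> \<open>The functional \<open>f\<close> isolates \<open>b\<close>; the remaining sum \<open>ws\<close> still has all its slices in \<open>Y\<close>.\<close>
      have slice_zs: "slice k V (\<lambda>x. g (i x)) (pure_sum k U V zs)
          = g (i a) \<odot>\<^bsub>V\<^esub> b \<oplus>\<^bsub>V\<^esub> slice k V (\<lambda>x. g (i x)) (pure_sum k U V ws)"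
        if "g \<in> linear_maps k M (self_module k)" for g
        using ab pure_tensor_closed[OF U V] pure_sum_closed[OF U V ws]
        by (simp add: zs linear_maps_add[OF slice_linear[OF U V fi[OF that]]] slice_pure[OF U V fi[OF that]])
      have "slice k V (\<lambda>x. f (i x)) (pure_sum k U V ws) = \<zero>\<^bsub>V\<^esub>"
        using f0 lin_span_superset[OF U fst_ws]
        by (intro slice_pure_sum_zero[OF U V fi[OF f] _ ws]) auto
      then have b: "b \<in> Y"
        using Suc.prems(2)[OF f] slice_zs[OF f] f1 ab by simp
      have "slice k V (\<lambda>x. g (i x)) (pure_sum k U V ws) \<in> Y"
        if g: "g \<in> linear_maps k M (self_module k)" for g
      proof -
        let ?s = "slice k V (\<lambda>x. g (i x)) (pure_sum k U V ws)"
        have s: "?s \<in> carrier V"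
          by (rule linear_maps_closed[OF slice_linear[OF U V fi[OF g]] pure_sum_closed[OF U V ws]])
        have gb: "g (i a) \<odot>\<^bsub>V\<^esub> b \<in> Y"
          using linear_maps_closed[OF fi[OF g] ab(1)] b
          by (intro submodule_smult[OF Y]) (simp_all add: self_module_def)
        have gbV: "g (i a) \<odot>\<^bsub>V\<^esub> b \<in> carrier V" by (rule submodule_carrier[OF Y gb])
        have "\<ominus>\<^bsub>V\<^esub> (g (i a) \<odot>\<^bsub>V\<^esub> b) \<oplus>\<^bsub>V\<^esub> (g (i a) \<odot>\<^bsub>V\<^esub> b \<oplus>\<^bsub>V\<^esub> ?s) \<in> Y"
          using Suc.prems(2)[OF g] slice_zs[OF g] submodule_add[OF Y V.submoduleE(3)[OF Y gb]] by simp
        also have "\<ominus>\<^bsub>V\<^esub> (g (i a) \<odot>\<^bsub>V\<^esub> b) \<oplus>\<^bsub>V\<^esub> (g (i a) \<odot>\<^bsub>V\<^esub> b \<oplus>\<^bsub>V\<^esub> ?s) = ?s"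
          using s gbV by (simp add: V.a_assoc[symmetric] V.l_neg)
        finally show ?thesis .
      qed
      then obtain zs' where "set zs' \<subseteq> carrier U \<times> Y" "pure_sum k U V ws = pure_sum k U V zs'"
        using Suc.hyps(1)[OF n ws] by blast
      then show ?thesis using ab b zs by (intro exI[of _ "(a, b) # zs'"]) simp
    qed
  qed
  moreover obtain zs where "set zs \<subseteq> carrier U \<times> carrier V" "t = pure_sum k U V zs"
    using tensor_eq_pure_sum[OF U V t] by blast
  ultimately show ?thesis using slices by blast
qed

lemma slice_tensor_map:
  assumes U: "module k U" and V: "module k V" and M: "module k M" and N: "module k N"
    and i: "i \<in> linear_maps k U M" and j: "j \<in> linear_maps k V N"
    and f: "f \<in> linear_maps k M (self_module k)" and t: "t \<in> carrier (tensor_product k U V)"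
  shows "slice k N f (tensor_map k M N i j t) = j (slice k V (\<lambda>x. f (i x)) t)"
proof (rule tensor_linear_eqI[OF U V N _ _ _ t])
  note fi = linear_maps_comp[OF i f]
  show "(\<lambda>t. slice k N f (tensor_map k M N i j t)) \<in> linear_maps k (tensor_product k U V) N"
    by (rule linear_maps_comp[OF tensor_map_linear[OF U V M N i j] slice_linear[OF M N f]])
  show "(\<lambda>t. j (slice k V (\<lambda>x. f (i x)) t)) \<in> linear_maps k (tensor_product k U V) N"
    by (rule linear_maps_comp[OF slice_linear[OF U V fi] j])
  fix x y assume xy: "x \<in> carrier U" "y \<in> carrier V"
  then have "f (i x) \<in> carrier k" using linear_maps_closed[OF fi xy(1)] by (simp add: self_module_def)
  then show "slice k N f (tensor_map k M N i j (pure_tensor k U V x y))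
      = j (slice k V (\<lambda>x. f (i x)) (pure_tensor k U V x y))"
    using xy linear_maps_closed[OF i] linear_maps_closed[OF j]
    by (simp add: tensor_map_pure[OF U V M N i j] slice_pure[OF M N f] slice_pure[OF U V fi]
        linear_maps_smult[OF j])
qed

lemma pure_sum_zero_right:
  assumes M: "module k M" and N: "module k N" and "set zs \<subseteq> carrier M \<times> {\<zero>\<^bsub>N\<^esub>}"
  shows "pure_sum k M N zs = \<zero>\<^bsub>tensor_product k M N\<^esub>"
proof -
  interpret N: module k N by fact
  interpret T: module k "tensor_product k M N" by (rule tensor_product_module[OF M N])
  have "pure_tensor k M N x \<zero>\<^bsub>N\<^esub> = \<zero>\<^bsub>tensor_product k M N\<^esub>" if "x \<in> carrier M" for x
    using pure_tensor_bilinear[OF M N] that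
    by (intro linear_maps_zero[OF N T.module_axioms]) (simp add: bilinear_map_def)
  then show ?thesis using assms(3) by (induction zs) auto
qed

text \<open>
  A slice of the image of \<open>t\<close> is the image of a slice of \<open>t\<close>. If the image of \<open>t\<close> is zero, then
  injectivity of \<open>j\<close> makes these slices of \<open>t\<close> zero, and the slice criterion for the zero subspace
  writes \<open>t\<close> as a sum of tensors \<open>x \<otimes> 0\<close>.
\<close>
lemma tensor_map_inj_on:
  assumes k: "field k" and U: "module k U" and V: "module k V" and M: "module k M" and N: "module k N"
    and i: "i \<in> linear_maps k U M" "inj_on i (carrier U)"
    and j: "j \<in> linear_maps k V N" "inj_on j (carrier V)"
  shows "inj_on (tensor_map k M N i j) (carrier (tensor_product k U V))"
proof (rule linear_maps_inj_onI[OF tensor_product_module[OF U V] tensor_product_module[OF M N]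
      tensor_map_linear[OF U V M N i(1) j(1)]])
  interpret V: module k V by fact
  fix t assume t: "t \<in> carrier (tensor_product k U V)"
    and 0: "tensor_map k M N i j t = \<zero>\<^bsub>tensor_product k M N\<^esub>"
  have "slice k V (\<lambda>x. f (i x)) t \<in> {\<zero>\<^bsub>V\<^esub>}" if f: "f \<in> linear_maps k M (self_module k)" for f
  proof -
    have "j (slice k V (\<lambda>x. f (i x)) t) = \<zero>\<^bsub>N\<^esub>"
      using slice_tensor_map[OF U V M N i(1) j(1) f t] 0
        linear_maps_zero[OF tensor_product_module[OF M N] N slice_linear[OF M N f]] by simp
    moreover have "slice k V (\<lambda>x. f (i x)) t \<in> carrier V"
      by (rule linear_maps_closed[OF slice_linear[OF U V linear_maps_comp[OF i(1) f]] t])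
    ultimately show ?thesis
      using j(2) linear_maps_zero[OF V N j(1)] V.zero_closed by (metis inj_onD singletonI)
  qed
  then obtain zs where "set zs \<subseteq> carrier U \<times> {\<zero>\<^bsub>V\<^esub>}" "t = pure_sum k U V zs"
    using pure_sum_of_slices[OF k U V M i submodule_trivial[OF V] t] by blast
  then show "t = \<zero>\<^bsub>tensor_product k U V\<^esub>" using pure_sum_zero_right[OF U V] by simp
qed

section \<open>Tensor products of subspaces\<close>

lemma linear_maps_inclusion:
  "U \<subseteq> carrier M \<Longrightarrow> id \<in> linear_maps k (M\<lparr>carrier := U\<rparr>) M"
  by (rule linear_mapsI) auto

lemma submodule_module: "module k M \<Longrightarrow> submodule U k M \<Longrightarrow> module k (M\<lparr>carrier := U\<rparr>)"
  by (rule submodule.submodule_is_module)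

text \<open>
  Replaces the tensor product of the subspaces by representations inside \<open>M \<otimes> N\<close>, which makes
  monotonicity and the behaviour under swapping the factors immediate.
\<close>
lemma mem_sub_tensor_iff:
  assumes M: "module k M" and N: "module k N" and U: "submodule U k M" and V: "submodule V k N"
  shows "t \<in> sub_tensor k M N U V \<longleftrightarrow> (\<exists>zs. set zs \<subseteq> U \<times> V \<and> t = pure_sum k M N zs)"
proof -
  let ?U = "M\<lparr>carrier := U\<rparr>" and ?V = "N\<lparr>carrier := V\<rparr>"
  note U' = submodule_module[OF M U] and V' = submodule_module[OF N V]
  note i = linear_maps_inclusion[OF submodule_subset[OF U], of k]
  note j = linear_maps_inclusion[OF submodule_subset[OF V], of k]
  have eq: "tensor_map k M N id id (pure_sum k ?U ?V zs) = pure_sum k M N zs"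
    if "set zs \<subseteq> U \<times> V" for zs
    using linear_map_pure_sum[OF U' V' M N tensor_map_linear[OF U' V' M N i j], of id zs] that
    by (simp add: tensor_map_pure[OF U' V' M N i j])
  show ?thesis
  proof
    assume "t \<in> sub_tensor k M N U V"
    then obtain s where s: "s \<in> carrier (tensor_product k ?U ?V)" "t = tensor_map k M N id id s"
      by (auto simp: sub_tensor_def)
    from tensor_eq_pure_sum[OF U' V' s(1)]
    obtain zs where "set zs \<subseteq> carrier ?U \<times> carrier ?V" "s = pure_sum k ?U ?V zs" .
    then show "\<exists>zs. set zs \<subseteq> U \<times> V \<and> t = pure_sum k M N zs" using s(2) eq by auto
  next
    assume "\<exists>zs. set zs \<subseteq> U \<times> V \<and> t = pure_sum k M N zs"
    then obtain zs where zs: "set zs \<subseteq> U \<times> V" "t = pure_sum k M N zs" by blast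
    then have "pure_sum k ?U ?V zs \<in> carrier (tensor_product k ?U ?V)"
      by (intro pure_sum_closed[OF U' V']) simp
    then show "t \<in> sub_tensor k M N U V" using zs eq by (auto simp: sub_tensor_def)
  qed
qed

lemma sub_tensor_mono:
  assumes M: "module k M" and N: "module k N" and "submodule U k M" "submodule V k N"
    and "submodule U' k M" "submodule V' k N" "U \<subseteq> U'" "V \<subseteq> V'" and "t \<in> sub_tensor k M N U V"
  shows "t \<in> sub_tensor k M N U' V'"
proof -
  obtain zs where zs: "set zs \<subseteq> U \<times> V" "t = pure_sum k M N zs"
    using assms(9) unfolding mem_sub_tensor_iff[OF M N assms(3,4)] by blast
  moreover have "U \<times> V \<subseteq> U' \<times> V'" using assms(7,8) by (rule Sigma_mono)
  ultimately show ?thesis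
    unfolding mem_sub_tensor_iff[OF M N assms(5,6)] by blast
qed

lemma sub_tensor_carrier:
  assumes M: "module k M" and N: "module k N"
  shows "sub_tensor k M N (carrier M) (carrier N) = carrier (tensor_product k M N)"
proof -
  note iff = mem_sub_tensor_iff[OF M N module.carrier_is_submodule[OF M] module.carrier_is_submodule[OF N]]
  show ?thesis
  proof (intro equalityI subsetI)
    fix t assume "t \<in> sub_tensor k M N (carrier M) (carrier N)"
    then show "t \<in> carrier (tensor_product k M N)" by (auto simp: iff pure_sum_closed[OF M N])
  next
    fix t assume "t \<in> carrier (tensor_product k M N)"
    from tensor_eq_pure_sum[OF M N this]
    obtain zs where "set zs \<subseteq> carrier M \<times> carrier N" "t = pure_sum k M N zs" .
    then show "t \<in> sub_tensor k M N (carrier M) (carrier N)" by (auto simp: iff)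
  qed
qed

lemma sub_tensor_subset:
  assumes M: "module k M" and N: "module k N" and U: "submodule U k M" and V: "submodule V k N"
    and t: "t \<in> sub_tensor k M N U V"
  shows "t \<in> carrier (tensor_product k M N)"
  using sub_tensor_mono[OF M N U V module.carrier_is_submodule[OF M] module.carrier_is_submodule[OF N]
      submodule_subset[OF U] submodule_subset[OF V] t] sub_tensor_carrier[OF M N] by simp

lemma slice_mem:
  assumes M: "module k M" and N: "module k N" and U: "submodule U k M" and V: "submodule V k N"
    and f: "f \<in> linear_maps k M (self_module k)" and t: "t \<in> sub_tensor k M N U V"
  shows "slice k N f t \<in> V"
proof -
  obtain zs where zs: "set zs \<subseteq> U \<times> V" "t = pure_sum k M N zs"
    using t by (auto simp: mem_sub_tensor_iff[OF M N U V])
  have "slice k N f (pure_sum k M N zs) \<in> V" using zs(1)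
  proof (induction zs)
    case Nil
    then show ?case
      using linear_maps_zero[OF tensor_product_module[OF M N] N slice_linear[OF M N f]]
        submodule_zero[OF V] by simp
  next
    case (Cons z zs)
    obtain x y where z: "z = (x, y)" by (cases z)
    have xy: "x \<in> carrier M" "y \<in> carrier N" "y \<in> V"
      using Cons.prems z submodule_subset[OF U] submodule_subset[OF V] by auto
    have zs: "set zs \<subseteq> carrier M \<times> carrier N"
      using Cons.prems submodule_subset[OF U] submodule_subset[OF V] by auto
    have "f x \<in> carrier k" using linear_maps_closed[OF f xy(1)] by (simp add: self_module_def)
    then have "f x \<odot>\<^bsub>N\<^esub> y \<oplus>\<^bsub>N\<^esub> slice k N f (pure_sum k M N zs) \<in> V"
      using xy Cons by (intro submodule_add[OF V] submodule_smult[OF V]) auto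
    then show ?case
      using xy zs pure_tensor_closed[OF M N] pure_sum_closed[OF M N]
      by (simp add: z linear_maps_add[OF slice_linear[OF M N f]] slice_pure[OF M N f])
  qed
  then show ?thesis using zs(2) by simp
qed

lemma mem_sub_tensor_of_slices:
  assumes k: "field k" and M: "module k M" and N: "module k N"
    and U: "submodule U k M" and V: "submodule V k N"
    and t: "t \<in> sub_tensor k M N U (carrier N)"
    and slices: "\<And>f. f \<in> linear_maps k M (self_module k) \<Longrightarrow> slice k N f t \<in> V"
  shows "t \<in> sub_tensor k M N U V"
proof -
  let ?U = "M\<lparr>carrier := U\<rparr>"
  note U' = submodule_module[OF M U]
  note i = linear_maps_inclusion[OF submodule_subset[OF U], of k]
  have j: "id \<in> linear_maps k N N" using linear_maps_inclusion[OF order_refl, of k N] by simp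
  obtain s where s: "s \<in> carrier (tensor_product k ?U N)" "t = tensor_map k M N id id s"
    using t by (auto simp: sub_tensor_def)
  have "\<exists>zs. set zs \<subseteq> carrier ?U \<times> V \<and> s = pure_sum k ?U N zs"
  proof (rule pure_sum_of_slices[OF k U' N M i _ V s(1)])
    show "slice k N (\<lambda>x. f (id x)) s \<in> V" if f: "f \<in> linear_maps k M (self_module k)" for f
      using slices[OF f] slice_tensor_map[OF U' N M N i j f s(1)] s(2) by simp
  qed simp
  then obtain zs where zs: "set zs \<subseteq> U \<times> V" "s = pure_sum k ?U N zs" by auto
  have "t = pure_sum k M N (map id zs)"
    unfolding s(2) zs(2) using zs(1) submodule_subset[OF V]
    by (intro linear_map_pure_sum[OF U' N M N tensor_map_linear[OF U' N M N i j]])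
      (auto simp: tensor_map_pure[OF U' N M N i j])
  then show ?thesis using zs(1) by (auto simp: mem_sub_tensor_iff[OF M N U V])
qed

text \<open>
  All slices lie in each \<open>Y \<in> \<Y>\<close>, hence in the intersection. Swapping the factors gives the
  corresponding fact for the left factor.
\<close>
lemma sub_tensor_Inter_right:
  assumes k: "field k" and M: "module k M" and N: "module k N" and U: "submodule U k M"
    and ne: "\<Y> \<noteq> {}" and sub: "\<And>Y. Y \<in> \<Y> \<Longrightarrow> submodule Y k N"
    and t: "t \<in> sub_tensor k M N U (carrier N)"
    and Y: "\<And>Y. Y \<in> \<Y> \<Longrightarrow> t \<in> sub_tensor k M N (carrier M) Y"
  shows "t \<in> sub_tensor k M N U (\<Inter>\<Y>)"
proof (rule mem_sub_tensor_of_slices[OF k M N U submodule_Inter[OF N ne sub] t])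
  fix f assume "f \<in> linear_maps k M (self_module k)"
  then show "slice k N f t \<in> \<Inter>\<Y>"
    using slice_mem[OF M N module.carrier_is_submodule[OF M] sub _ Y] by blast
qed

definition tensor_swap ::
    "('k, 'r) ring_scheme \<Rightarrow> ('k, 'm, 'x) module_scheme \<Rightarrow> ('k, 'n, 'y) module_scheme
      \<Rightarrow> ('k, 'm, 'n) tensor \<Rightarrow> ('k, 'n, 'm) tensor"
  where "tensor_swap k M N = tensor_lift k (tensor_product k N M) (\<lambda>x y. pure_tensor k N M y x)"

lemma tensor_swap_pure_sum:
  assumes M: "module k M" and N: "module k N" and "set zs \<subseteq> carrier M \<times> carrier N"
  shows "tensor_swap k M N (pure_sum k M N zs) = pure_sum k N M (map prod.swap zs)"
proof -
  note b = bilinear_map_flip[OF pure_tensor_bilinear[OF N M]]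
  note T = tensor_product_module[OF N M]
  show ?thesis
    unfolding tensor_swap_def
    by (rule linear_map_pure_sum[OF M N N M tensor_lift_linear[OF M N T b] _ assms(3)])
      (simp add: tensor_lift_pure[OF M N T b])
qed

lemma tensor_swap_swap:
  assumes M: "module k M" and N: "module k N" and t: "t \<in> carrier (tensor_product k M N)"
  shows "tensor_swap k N M (tensor_swap k M N t) = t"
proof -
  from tensor_eq_pure_sum[OF M N t]
  obtain zs where zs: "set zs \<subseteq> carrier M \<times> carrier N" "t = pure_sum k M N zs" .
  then have "set (map prod.swap zs) \<subseteq> carrier N \<times> carrier M" by auto
  then show ?thesis
    using zs by (simp add: tensor_swap_pure_sum[OF M N] tensor_swap_pure_sum[OF N M] comp_def)
qed

lemma tensor_swap_sub_tensor:
  assumes M: "module k M" and N: "module k N" and U: "submodule U k M" and V: "submodule V k N"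
    and t: "t \<in> sub_tensor k M N U V"
  shows "tensor_swap k M N t \<in> sub_tensor k N M V U"
proof -
  obtain zs where zs: "set zs \<subseteq> U \<times> V" "t = pure_sum k M N zs"
    using t by (auto simp: mem_sub_tensor_iff[OF M N U V])
  then have "set zs \<subseteq> carrier M \<times> carrier N" and swap: "set (map prod.swap zs) \<subseteq> V \<times> U"
    using submodule_subset[OF U] submodule_subset[OF V] by auto
  then have "tensor_swap k M N t = pure_sum k N M (map prod.swap zs)"
    using zs(2) by (simp add: tensor_swap_pure_sum[OF M N])
  then show ?thesis unfolding mem_sub_tensor_iff[OF N M V U] using swap by blast
qed

lemma sub_tensor_Inter_left:
  assumes k: "field k" and M: "module k M" and N: "module k N" and V: "submodule V k N"
    and ne: "\<X> \<noteq> {}" and sub: "\<And>X. X \<in> \<X> \<Longrightarrow> submodule X k M"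
    and t: "t \<in> sub_tensor k M N (carrier M) V"
    and X: "\<And>X. X \<in> \<X> \<Longrightarrow> t \<in> sub_tensor k M N X (carrier N)"
  shows "t \<in> sub_tensor k M N (\<Inter>\<X>) V"
proof -
  note carrM = module.carrier_is_submodule[OF M] and carrN = module.carrier_is_submodule[OF N]
  have "tensor_swap k M N t \<in> sub_tensor k N M V (\<Inter>\<X>)"
    using sub_tensor_Inter_right[OF k N M V ne sub] tensor_swap_sub_tensor[OF M N carrM V t]
      tensor_swap_sub_tensor[OF M N sub carrN X] by blast
  from tensor_swap_sub_tensor[OF N M V submodule_Inter[OF M ne sub] this]
  show ?thesis
    using tensor_swap_swap[OF M N sub_tensor_subset[OF M N carrM V t]] by simp
qed

text \<open>
  The two factors are treated one after the other: \<open>t\<close> lies in \<open>M \<otimes> \<Inter>\<C>\<close>, and then in \<open>\<Inter>\<C> \<otimes> \<Inter>\<C>\<close>.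
\<close>
lemma sub_tensor_Inter:
  assumes k: "field k" and M: "module k M"
    and ne: "\<C> \<noteq> {}" and sub: "\<And>C. C \<in> \<C> \<Longrightarrow> submodule C k M"
    and t: "\<And>C. C \<in> \<C> \<Longrightarrow> t \<in> sub_tensor k M M C C"
  shows "t \<in> sub_tensor k M M (\<Inter>\<C>) (\<Inter>\<C>)"
proof -
  note carr = module.carrier_is_submodule[OF M] and Int = submodule_Inter[OF M ne sub]
  have left: "t \<in> sub_tensor k M M C (carrier M)" if C: "C \<in> \<C>" for C
    by (rule sub_tensor_mono[OF M M sub[OF C] sub[OF C] sub[OF C] carr order_refl
          submodule_subset[OF sub[OF C]] t[OF C]])
  have right: "t \<in> sub_tensor k M M (carrier M) C" if C: "C \<in> \<C>" for C
    by (rule sub_tensor_mono[OF M M sub[OF C] sub[OF C] carr sub[OF C]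
          submodule_subset[OF sub[OF C]] order_refl t[OF C]])
  obtain C where C: "C \<in> \<C>" using ne by blast
  have all: "t \<in> sub_tensor k M M (carrier M) (carrier M)"
    unfolding sub_tensor_carrier[OF M M] by (rule sub_tensor_subset[OF M M sub[OF C] sub[OF C] t[OF C]])
  have "t \<in> sub_tensor k M M (carrier M) (\<Inter>\<C>)"
    by (rule sub_tensor_Inter_right[OF k M M carr ne sub all right])
  from sub_tensor_Inter_left[OF k M M Int ne sub this left] show ?thesis .
qed


section \<open>Least subspaces and subcoalgebras\<close>

text \<open>
  The least element exists because subcoalgebras are closed under intersections and the whole
  coalgebra is one of them.
\<close>
lemma generated_subcoalgebra_facts:
  assumes k: "field k" and G: "coalgebra k G" and X: "X \<subseteq> carrier G"
  shows generated_subcoalgebra_subcoalgebra: "subcoalgebra k G (generated_subcoalgebra k G X)"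
    and generated_subcoalgebra_superset: "X \<subseteq> generated_subcoalgebra k G X"
    and generated_subcoalgebra_least: "subcoalgebra k G C \<Longrightarrow> X \<subseteq> C \<Longrightarrow> generated_subcoalgebra k G X \<subseteq> C"
proof -
  interpret G: coalgebra k G by fact
  have M: "module k G" by (rule G.module_axioms)
  define \<C> where "\<C> = {C. subcoalgebra k G C \<and> X \<subseteq> C}"
  have "subcoalgebra k G (carrier G)"
    using module.carrier_is_submodule[OF M] linear_maps_closed[OF G.comult_linear]
    by (auto simp: subcoalgebra_def sub_tensor_carrier[OF M M])
  then have ne: "\<C> \<noteq> {}" using X by (auto simp: \<C>_def)
  have sub: "submodule C k G" if "C \<in> \<C>" for C using that by (simp add: \<C>_def subcoalgebra_def)
  have "subcoalgebra k G (\<Inter>\<C>)"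
    unfolding subcoalgebra_def
  proof (intro conjI subsetI submodule_Inter[OF M ne sub])
    fix t assume "t \<in> comult G ` \<Inter>\<C>"
    then have t: "t \<in> sub_tensor k G G C C" if "C \<in> \<C>" for C
      using that by (auto simp: \<C>_def subcoalgebra_def)
    show "t \<in> sub_tensor k G G (\<Inter>\<C>) (\<Inter>\<C>)"
      by (rule sub_tensor_Inter[OF k M ne sub t])
  qed
  then have least: "generated_subcoalgebra k G X = \<Inter>\<C>"
    unfolding generated_subcoalgebra_def by (intro Least_equality) (auto simp: \<C>_def)
  show "subcoalgebra k G (generated_subcoalgebra k G X)" using least \<open>subcoalgebra k G (\<Inter>\<C>)\<close> by simp
  show "X \<subseteq> generated_subcoalgebra k G X" using least by (auto simp: \<C>_def)
  show "subcoalgebra k G C \<Longrightarrow> X \<subseteq> C \<Longrightarrow> generated_subcoalgebra k G X \<subseteq> C"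
    using least by (auto simp: \<C>_def)
qed

lemma objects_group_modules_in:
  "M \<in> objects (group_modules_in k G Y) \<longleftrightarrow>
    right_comodule k G M \<and> coact M ` carrier M \<subseteq> sub_tensor k M G (carrier M) Y"
  by (simp add: group_modules_in_def comodule_cat_def)

text \<open>
  The least subspace is the intersection of all subspaces through which the coactions factor, the
  whole of \<open>G\<close> being one of them.
\<close>
lemma least_coefficient_space:
  assumes k: "field k" and G: "coalgebra k G" and \<M>: "\<And>M. M \<in> \<M> \<Longrightarrow> right_comodule k G M"
    and V_def: "V = (LEAST Y. submodule Y k G \<and> (\<forall>M\<in>\<M>. M \<in> objects (group_modules_in k G Y)))"
  shows least_coefficient_space_submodule: "submodule V k G"
    and least_coefficient_space_mem: "M \<in> \<M> \<Longrightarrow> M \<in> objects (group_modules_in k G V)"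
    and least_coefficient_space_least: "submodule Y k G \<Longrightarrow>
      (\<And>M. M \<in> \<M> \<Longrightarrow> M \<in> objects (group_modules_in k G Y)) \<Longrightarrow> V \<subseteq> Y"
proof -
  interpret G: coalgebra k G by fact
  have GM: "module k G" by (rule G.module_axioms)
  note carrG = module.carrier_is_submodule[OF GM]
  define \<Y> where "\<Y> = {Y. submodule Y k G \<and> (\<forall>M\<in>\<M>. M \<in> objects (group_modules_in k G Y))}"
  have coact: "coact M x \<in> carrier (tensor_product k M G)" "module k M"
    if "M \<in> \<M>" "x \<in> carrier M" for M x
  proof -
    interpret M: right_comodule k G M by (rule \<M>[OF that(1)])
    show "coact M x \<in> carrier (tensor_product k M G)"
      by (rule linear_maps_closed[OF M.coact_linear that(2)])
    show "module k M" by (rule M.module_axioms)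
  qed
  have "carrier G \<in> \<Y>"
    using carrG \<M> coact by (auto simp: \<Y>_def objects_group_modules_in sub_tensor_carrier[OF _ GM])
  then have ne: "\<Y> \<noteq> {}" by blast
  have sub: "submodule Y k G" if "Y \<in> \<Y>" for Y using that by (simp add: \<Y>_def)
  have Int: "\<Inter>\<Y> \<in> \<Y>"
    unfolding \<Y>_def mem_Collect_eq
  proof (intro conjI ballI)
    show "submodule (\<Inter>{Y. submodule Y k G \<and> (\<forall>M\<in>\<M>. M \<in> objects (group_modules_in k G Y))}) k G"
      using submodule_Inter[OF GM ne sub] by (simp add: \<Y>_def)
    fix M assume M: "M \<in> \<M>"
    have "coact M x \<in> sub_tensor k M G (carrier M) (\<Inter>\<Y>)" if x: "x \<in> carrier M" for x
    proof -
      note carrM = module.carrier_is_submodule[OF coact(2)[OF M x]]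
      show ?thesis
      proof (rule sub_tensor_Inter_right[OF k coact(2)[OF M x] GM carrM ne sub])
        show "coact M x \<in> sub_tensor k M G (carrier M) (carrier G)"
          using coact[OF M x] by (simp add: sub_tensor_carrier[OF _ GM])
        show "coact M x \<in> sub_tensor k M G (carrier M) Y" if "Y \<in> \<Y>" for Y
          using that x M by (auto simp: \<Y>_def objects_group_modules_in)
      qed
    qed
    then show "M \<in> objects (group_modules_in k G
        (\<Inter>{Y. submodule Y k G \<and> (\<forall>M\<in>\<M>. M \<in> objects (group_modules_in k G Y))}))"
      using \<M>[OF M] by (auto simp: \<Y>_def objects_group_modules_in)
  qed
  have "V = \<Inter>\<Y>"
    unfolding V_def using Int by (intro Least_equality) (auto simp: \<Y>_def)
  then show "submodule V k G" "M \<in> \<M> \<Longrightarrow> M \<in> objects (group_modules_in k G V)"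
    "submodule Y k G \<Longrightarrow> (\<And>M. M \<in> \<M> \<Longrightarrow> M \<in> objects (group_modules_in k G Y)) \<Longrightarrow> V \<subseteq> Y"
    using Int by (auto simp: \<Y>_def)
qed

section \<open>Comodules over a coalgebra and over a larger one\<close>

text \<open>
  Lifts along an injective linear map are linear; this applies both to the comultiplication of a
  subcoalgebra and to coactions with values in \<open>M \<otimes> C\<close>.
\<close>
lemma linear_maps_factor:
  assumes A: "module k A" and B: "module k B"
    and j: "j \<in> linear_maps k B C" "inj_on j (carrier B)" and h: "h \<in> linear_maps k A C"
    and g: "\<And>x. x \<in> carrier A \<Longrightarrow> g x \<in> carrier B" "\<And>x. x \<in> carrier A \<Longrightarrow> j (g x) = h x"
  shows "g \<in> linear_maps k A B"
proof -
  interpret A: module k A by fact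
  interpret B: module k B by fact
  show ?thesis
  proof (rule linear_mapsI)
    fix x y assume xy: "x \<in> carrier A" "y \<in> carrier A"
    then have "j (g (x \<oplus>\<^bsub>A\<^esub> y)) = j (g x \<oplus>\<^bsub>B\<^esub> g y)"
      by (simp add: g linear_maps_add[OF j(1)] linear_maps_add[OF h])
    then show "g (x \<oplus>\<^bsub>A\<^esub> y) = g x \<oplus>\<^bsub>B\<^esub> g y"
      using xy g(1) by (intro inj_onD[OF j(2)]) simp_all
  next
    fix c x assume cx: "c \<in> carrier k" "x \<in> carrier A"
    then have "j (g (c \<odot>\<^bsub>A\<^esub> x)) = j (c \<odot>\<^bsub>B\<^esub> g x)"
      by (simp add: g linear_maps_smult[OF j(1)] linear_maps_smult[OF h])
    then show "g (c \<odot>\<^bsub>A\<^esub> x) = c \<odot>\<^bsub>B\<^esub> g x"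
      using cx g(1) by (intro inj_onD[OF j(2)]) simp_all
  qed (rule g)
qed

lemma module_cong:
  assumes M: "module k M" and "carrier N = carrier M" "ring.add N = ring.add M"
    "ring.zero N = ring.zero M" "smult N = smult M"
  shows "module k N"
proof -
  interpret M: module k M by fact
  have "abelian_group N"
  proof (rule abelian_groupI)
    fix x assume "x \<in> carrier N"
    then show "\<exists>y\<in>carrier N. y \<oplus>\<^bsub>N\<^esub> x = \<zero>\<^bsub>N\<^esub>"
      by (intro bexI[of _ "\<ominus>\<^bsub>M\<^esub> x"]) (simp_all add: assms(2-) M.l_neg)
  qed (simp_all add: assms(2-) M.a_ac)
  then show ?thesis
    by (rule moduleI[OF M.R.is_cring])
      (simp_all add: assms(2-) M.smult_l_distr M.smult_r_distr M.smult_assoc1)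
qed

text \<open>
  Tensor products do not see the comultiplication or coaction stored in a record, so they are
  unchanged when these fields are updated.
\<close>
lemma tensor_product_cong:
  assumes "carrier M' = carrier M" "ring.add M' = ring.add M" "smult M' = smult M"
    and "carrier N' = carrier N" "ring.add N' = ring.add N" "smult N' = smult N"
  shows "tensor_product k M' N' = tensor_product k M N" "pure_tensor k M' N' = pure_tensor k M N"
  by (simp_all add: tensor_product_def pure_tensor_def tensor_kernel_def bilinear_relations_def
      assms fun_eq_iff)

lemma coact_update_tensor:
  fixes M :: "('k, 'm, 'c) comodule"
  shows "tensor_product k (M\<lparr>coact := r\<rparr>) N = tensor_product k M N"
    and "pure_tensor k (M\<lparr>coact := r\<rparr>) N = pure_tensor k M N"
  by (rule tensor_product_cong; simp)+

lemma coact_update_simps: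
  fixes M :: "('k, 'm, 'c) comodule"
  shows "linear_maps k (M\<lparr>coact := r\<rparr>) P = linear_maps k M P"
    and "linear_maps k L (M\<lparr>coact := r\<rparr>) = linear_maps k L M"
    and "tensor_map k (M\<lparr>coact := r\<rparr>) N = tensor_map k M N"
    and "tensor_lift k (M\<lparr>coact := r\<rparr>) = tensor_lift k M"
    and "tensor_assoc k (M\<lparr>coact := r\<rparr>) N Q = tensor_assoc k M N Q"
    and "module k (M\<lparr>coact := r\<rparr>) \<longleftrightarrow> module k M"
proof -
  show "linear_maps k (M\<lparr>coact := r\<rparr>) P = linear_maps k M P"
    "linear_maps k L (M\<lparr>coact := r\<rparr>) = linear_maps k L M"
    by (simp_all add: linear_maps_def)
  show "tensor_map k (M\<lparr>coact := r\<rparr>) N = tensor_map k M N"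
    by (simp add: tensor_map_def coact_update_tensor fun_eq_iff)
  show "tensor_lift k (M\<lparr>coact := r\<rparr>) = tensor_lift k M"
    by (simp add: tensor_lift_def fun_eq_iff finsum_def finprod_def)
  show "tensor_assoc k (M\<lparr>coact := r\<rparr>) N Q = tensor_assoc k M N Q"
    by (simp add: tensor_assoc_def coact_update_tensor)
  show "module k (M\<lparr>coact := r\<rparr>) \<longleftrightarrow> module k M"
    using module_cong[of k M "M\<lparr>coact := r\<rparr>"] module_cong[of k "M\<lparr>coact := r\<rparr>" M] by auto
qed

text \<open>
  The situation of a subcoalgebra \<open>D\<close> of \<open>G\<close>, with \<open>D\<close> a record of its own whose comultiplication
  takes values in \<open>D \<otimes> D\<close>.
\<close>
locale coalgebra_inclusion =
  fixes k :: "('k, 'r) ring_scheme" and D :: "('k, 'a, 'x) coalgebra_scheme"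
    and G :: "('k, 'a, 'y) coalgebra_scheme"
  assumes field: "field k" and D: "module k D" and G: "coalgebra k G"
    and incl: "id \<in> linear_maps k D G"
    and comult_linear_D: "comult D \<in> linear_maps k D (tensor_product k D D)"
    and comult_incl: "d \<in> carrier D \<Longrightarrow> tensor_map k G G id id (comult D d) = comult G d"
    and counit_incl: "counit D = counit G"
begin

lemma G_module: "module k G"
proof -
  interpret coalgebra k G by (rule G)
  show ?thesis by (rule module_axioms)
qed

lemma id_linear: "id \<in> linear_maps k L L"
  by (rule linear_mapsI) simp_all

lemmas DD = tensor_product_module[OF D D]
lemmas GG = tensor_product_module[OF G_module G_module]

text \<open>
  The embeddings of \<open>D \<otimes> D\<close>, of \<open>M \<otimes> D\<close> and of \<open>M \<otimes> (D \<otimes> D)\<close> are needed: coassociativity over \<open>D\<close> is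
  an equation in the last of these spaces, and it is compared with the one over \<open>G\<close> by naturality of
  both sides.
\<close>
definition incl_square where "incl_square = tensor_map k G G id id"

lemmas incl_square_linear = tensor_map_linear[OF D D G_module G_module incl incl, folded incl_square_def]
lemmas incl_square_pure = tensor_map_pure[OF D D G_module G_module incl incl, folded incl_square_def]
lemmas incl_square_inj =
  tensor_map_inj_on[OF field D D G_module G_module incl inj_on_id incl inj_on_id, folded incl_square_def]

definition incl_tensor :: "('k, 'm, 'z) module_scheme \<Rightarrow> ('k, 'm, 'a) tensor \<Rightarrow> ('k, 'm, 'a) tensor"
  where "incl_tensor M = tensor_map k M G id id"

definition incl_tensor_square :: "('k, 'm, 'z) module_scheme
    \<Rightarrow> ('k, 'm, ('k, 'a, 'a) tensor) tensor \<Rightarrow> ('k, 'm, ('k, 'a, 'a) tensor) tensor"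
  where "incl_tensor_square M = tensor_map k M (tensor_product k G G) id incl_square"

context
  fixes M :: "('k, 'm, 'z) module_scheme"
  assumes M: "module k M"
begin

lemmas MD = tensor_product_module[OF M D]
lemmas MG = tensor_product_module[OF M G_module]

lemmas incl_tensor_linear = tensor_map_linear[OF M D M G_module id_linear incl, folded incl_tensor_def]
lemmas incl_tensor_pure = tensor_map_pure[OF M D M G_module id_linear incl, folded incl_tensor_def]
lemmas incl_tensor_inj = tensor_map_inj_on[OF field M D M G_module id_linear inj_on_id incl inj_on_id, folded incl_tensor_def]
lemmas incl_tensor_square_linear = tensor_map_linear[OF M DD M GG id_linear incl_square_linear, folded incl_tensor_square_def]
lemmas incl_tensor_square_pure = tensor_map_pure[OF M DD M GG id_linear incl_square_linear, folded incl_tensor_square_def]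
lemmas incl_tensor_square_inj = tensor_map_inj_on[OF field M DD M GG id_linear inj_on_id incl_square_linear incl_square_inj, folded incl_tensor_square_def]

lemma incl_tensor_square_comult:
  assumes t: "t \<in> carrier (tensor_product k M D)"
  shows "incl_tensor_square M (tensor_map k M (tensor_product k D D) id (comult D) t)
    = tensor_map k M (tensor_product k G G) id (comult G) (incl_tensor M t)"
proof (rule tensor_linear_eqI[OF M D tensor_product_module[OF M GG] _ _ _ t])
  interpret G: coalgebra k G by (rule G)
  note l = tensor_map_linear[OF M D M DD id_linear comult_linear_D]
    and p = tensor_map_pure[OF M D M DD id_linear comult_linear_D]
  note l' = tensor_map_linear[OF M G_module M GG id_linear G.comult_linear]
    and p' = tensor_map_pure[OF M G_module M GG id_linear G.comult_linear]
  show "(\<lambda>t. incl_tensor_square M (tensor_map k M (tensor_product k D D) id (comult D) t))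
      \<in> linear_maps k (tensor_product k M D) (tensor_product k M (tensor_product k G G))"
    by (rule linear_maps_comp[OF l incl_tensor_square_linear])
  show "(\<lambda>t. tensor_map k M (tensor_product k G G) id (comult G) (incl_tensor M t))
      \<in> linear_maps k (tensor_product k M D) (tensor_product k M (tensor_product k G G))"
    by (rule linear_maps_comp[OF incl_tensor_linear l'])
  fix x d assume xd: "x \<in> carrier M" "d \<in> carrier D"
  then have "d \<in> carrier G" "comult D d \<in> carrier (tensor_product k D D)"
    using linear_maps_closed[OF incl] linear_maps_closed[OF comult_linear_D] by auto
  then show "incl_tensor_square M (tensor_map k M (tensor_product k D D) id (comult D) (pure_tensor k M D x d))
      = tensor_map k M (tensor_product k G G) id (comult G) (incl_tensor M (pure_tensor k M D x d))"
    using xd by (simp add: p p' incl_tensor_pure incl_tensor_square_pure) (simp add: incl_square_def comult_incl)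
qed

lemma incl_tensor_square_assoc_pure:
  assumes s: "s \<in> carrier (tensor_product k M D)" and d: "d \<in> carrier D"
  shows "incl_tensor_square M (tensor_assoc k M D D (pure_tensor k (tensor_product k M D) D s d))
    = tensor_assoc k M G G (pure_tensor k (tensor_product k M G) G (incl_tensor M s) d)"
proof (rule tensor_linear_eqI[OF M D tensor_product_module[OF M GG] _ _ _ s])
  have dG: "d \<in> carrier G" using linear_maps_closed[OF incl d] by simp
  have "(\<lambda>s. pure_tensor k (tensor_product k M D) D s d)
      \<in> linear_maps k (tensor_product k M D) (tensor_product k (tensor_product k M D) D)"
    using pure_tensor_bilinear[OF MD D] d by (simp add: bilinear_map_def)
  from linear_maps_comp[OF linear_maps_comp[OF this tensor_assoc_linear[OF M D D]] incl_tensor_square_linear]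
  show "(\<lambda>s. incl_tensor_square M (tensor_assoc k M D D (pure_tensor k (tensor_product k M D) D s d)))
      \<in> linear_maps k (tensor_product k M D) (tensor_product k M (tensor_product k G G))" .
  have "(\<lambda>s. pure_tensor k (tensor_product k M G) G s d)
      \<in> linear_maps k (tensor_product k M G) (tensor_product k (tensor_product k M G) G)"
    using pure_tensor_bilinear[OF MG G_module] dG by (simp add: bilinear_map_def)
  from linear_maps_comp[OF linear_maps_comp[OF incl_tensor_linear this] tensor_assoc_linear[OF M G_module G_module]]
  show "(\<lambda>s. tensor_assoc k M G G (pure_tensor k (tensor_product k M G) G (incl_tensor M s) d))
      \<in> linear_maps k (tensor_product k M D) (tensor_product k M (tensor_product k G G))" .
  fix x e assume xe: "x \<in> carrier M" "e \<in> carrier D"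
  then have "e \<in> carrier G" using linear_maps_closed[OF incl] by auto
  then show "incl_tensor_square M (tensor_assoc k M D D (pure_tensor k (tensor_product k M D) D (pure_tensor k M D x e) d))
      = tensor_assoc k M G G (pure_tensor k (tensor_product k M G) G (incl_tensor M (pure_tensor k M D x e)) d)"
    using xe d dG pure_tensor_closed[OF D D]
    by (simp add: tensor_assoc_pure_pure[OF M D D] tensor_assoc_pure_pure[OF M G_module G_module]
        incl_tensor_pure incl_tensor_square_pure incl_square_pure)
qed

lemma incl_tensor_square_assoc_coact:
  assumes r: "r \<in> linear_maps k M (tensor_product k M D)"
    and r': "\<And>m. m \<in> carrier M \<Longrightarrow> r' m = incl_tensor M (r m)"
    and t: "t \<in> carrier (tensor_product k M D)"
  shows "incl_tensor_square M (tensor_assoc k M D D (tensor_map k (tensor_product k M D) D r id t))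
    = tensor_assoc k M G G (tensor_map k (tensor_product k M G) G r' id (incl_tensor M t))"
proof (rule tensor_linear_eqI[OF M D tensor_product_module[OF M GG] _ _ _ t])
  have r'_linear: "r' \<in> linear_maps k M (tensor_product k M G)"
  proof -
    interpret M: module k M by (rule M)
    show ?thesis
      using linear_maps_comp[OF r incl_tensor_linear] by (auto simp: linear_maps_def r' Pi_def)
  qed
  note l = tensor_map_linear[OF M D MD D r id_linear] and p = tensor_map_pure[OF M D MD D r id_linear]
  note l' = tensor_map_linear[OF M G_module MG G_module r'_linear id_linear]
    and p' = tensor_map_pure[OF M G_module MG G_module r'_linear id_linear]
  show "(\<lambda>t. incl_tensor_square M (tensor_assoc k M D D (tensor_map k (tensor_product k M D) D r id t)))
      \<in> linear_maps k (tensor_product k M D) (tensor_product k M (tensor_product k G G))"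
    by (rule linear_maps_comp[OF linear_maps_comp[OF l tensor_assoc_linear[OF M D D]] incl_tensor_square_linear])
  show "(\<lambda>t. tensor_assoc k M G G (tensor_map k (tensor_product k M G) G r' id (incl_tensor M t)))
      \<in> linear_maps k (tensor_product k M D) (tensor_product k M (tensor_product k G G))"
    by (rule linear_maps_comp[OF linear_maps_comp[OF incl_tensor_linear l'] tensor_assoc_linear[OF M G_module G_module]])
  fix x d assume xd: "x \<in> carrier M" "d \<in> carrier D"
  then have "d \<in> carrier G" using linear_maps_closed[OF incl] by auto
  then show "incl_tensor_square M (tensor_assoc k M D D (tensor_map k (tensor_product k M D) D r id (pure_tensor k M D x d)))
      = tensor_assoc k M G G (tensor_map k (tensor_product k M G) G r' id (incl_tensor M (pure_tensor k M D x d)))"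
    using xd linear_maps_closed[OF r]
    by (simp add: p p' incl_tensor_pure incl_tensor_square_assoc_pure r')
qed

lemma counit_incl_tensor:
  assumes t: "t \<in> carrier (tensor_product k M D)"
  shows "tensor_lift k M (\<lambda>x c. counit D c \<odot>\<^bsub>M\<^esub> x) t = tensor_lift k M (\<lambda>x c. counit G c \<odot>\<^bsub>M\<^esub> x) (incl_tensor M t)"
proof (rule tensor_linear_eqI[OF M D M _ _ _ t])
  interpret G: coalgebra k G by (rule G)
  have e: "counit D \<in> linear_maps k D (self_module k)"
    using linear_maps_comp[OF incl G.counit_linear] counit_incl by simp
  note b = bilinear_map_flip[OF bilinear_smult_left[OF M e]]
    and b' = bilinear_map_flip[OF bilinear_smult_left[OF M G.counit_linear]]
  show "tensor_lift k M (\<lambda>x c. counit D c \<odot>\<^bsub>M\<^esub> x) \<in> linear_maps k (tensor_product k M D) M"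
    by (rule tensor_lift_linear[OF M D M b])
  show "(\<lambda>t. tensor_lift k M (\<lambda>x c. counit G c \<odot>\<^bsub>M\<^esub> x) (incl_tensor M t)) \<in> linear_maps k (tensor_product k M D) M"
    by (rule linear_maps_comp[OF incl_tensor_linear tensor_lift_linear[OF M G_module M b']])
  fix x d assume xd: "x \<in> carrier M" "d \<in> carrier D"
  then have "d \<in> carrier G" using linear_maps_closed[OF incl] by auto
  then show "tensor_lift k M (\<lambda>x c. counit D c \<odot>\<^bsub>M\<^esub> x) (pure_tensor k M D x d)
      = tensor_lift k M (\<lambda>x c. counit G c \<odot>\<^bsub>M\<^esub> x) (incl_tensor M (pure_tensor k M D x d))"
    using xd
    by (simp add: incl_tensor_pure tensor_lift_pure[OF M D M b, unfolded counit_incl] tensor_lift_pure[OF M G_module M b'] counit_incl)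
qed

end

lemma incl_tensor_tensor_map:
  assumes M: "module k M" and N: "module k N" and f: "f \<in> linear_maps k M N"
    and t: "t \<in> carrier (tensor_product k M D)"
  shows "incl_tensor N (tensor_map k N D f id t) = tensor_map k N G f id (incl_tensor M t)"
proof (rule tensor_linear_eqI[OF M D MG[OF N] _ _ _ t])
  note l = tensor_map_linear[OF M D N D f id_linear] and p = tensor_map_pure[OF M D N D f id_linear]
  note l' = tensor_map_linear[OF M G_module N G_module f id_linear]
    and p' = tensor_map_pure[OF M G_module N G_module f id_linear]
  show "(\<lambda>t. incl_tensor N (tensor_map k N D f id t)) \<in> linear_maps k (tensor_product k M D) (tensor_product k N G)"
    by (rule linear_maps_comp[OF l incl_tensor_linear[OF N]])
  show "(\<lambda>t. tensor_map k N G f id (incl_tensor M t)) \<in> linear_maps k (tensor_product k M D) (tensor_product k N G)"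
    by (rule linear_maps_comp[OF incl_tensor_linear[OF M] l'])
  fix x d assume xd: "x \<in> carrier M" "d \<in> carrier D"
  then show "incl_tensor N (tensor_map k N D f id (pure_tensor k M D x d))
      = tensor_map k N G f id (incl_tensor M (pure_tensor k M D x d))"
    using linear_maps_closed[OF incl xd(2)] linear_maps_closed[OF f xd(1)]
    by (simp add: p p' incl_tensor_pure[OF M] incl_tensor_pure[OF N])
qed

text \<open>
  The embedding of \<open>M \<otimes> (D \<otimes> D)\<close> into \<open>M \<otimes> (G \<otimes> G)\<close> takes the two sides of coassociativity over \<open>D\<close> to
  the two sides over \<open>G\<close>, and it is injective.
\<close>
lemma right_comodule_iff:
  fixes M :: "('k, 'm, 'a) comodule"
  assumes M: "module k M" and r: "coact M \<in> linear_maps k M (tensor_product k M D)"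
    and ext: "coact M \<in> extensional (carrier M)"
  shows "right_comodule k G (M\<lparr>coact := restrict (\<lambda>m. incl_tensor M (coact M m)) (carrier M)\<rparr>)
    \<longleftrightarrow> right_comodule k D M"
proof -
  let ?r = "restrict (\<lambda>m. incl_tensor M (coact M m)) (carrier M)"
  have r'_lin: "?r \<in> linear_maps k M (tensor_product k M G)"
  proof -
    interpret M: module k M by (rule M)
    show ?thesis
      using linear_maps_comp[OF r incl_tensor_linear[OF M]] by (auto simp: linear_maps_def Pi_def)
  qed
  have eq: "tensor_assoc k M G G (tensor_map k (tensor_product k M G) G ?r id (?r m))
      = tensor_map k M (tensor_product k G G) id (comult G) (?r m)
    \<longleftrightarrow> tensor_assoc k M D D (tensor_map k (tensor_product k M D) D (coact M) id (coact M m))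
      = tensor_map k M (tensor_product k D D) id (comult D) (coact M m)"
    (is "?L \<longleftrightarrow> ?u = ?v") if m: "m \<in> carrier M" for m
  proof -
    note rm = linear_maps_closed[OF r m]
    have u: "?u \<in> carrier (tensor_product k M (tensor_product k D D))"
      by (rule linear_maps_closed[OF tensor_assoc_linear[OF M D D]
            linear_maps_closed[OF tensor_map_linear[OF M D MD[OF M] D r id_linear] rm]])
    have v: "?v \<in> carrier (tensor_product k M (tensor_product k D D))"
      by (rule linear_maps_closed[OF tensor_map_linear[OF M D M DD id_linear comult_linear_D] rm])
    have "incl_tensor_square M ?u = tensor_assoc k M G G (tensor_map k (tensor_product k M G) G ?r id (incl_tensor M (coact M m)))"
      by (rule incl_tensor_square_assoc_coact[OF M r _ rm]) simp
    moreover have "incl_tensor_square M ?v = tensor_map k M (tensor_product k G G) id (comult G) (incl_tensor M (coact M m))"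
      by (rule incl_tensor_square_comult[OF M rm])
    moreover have "incl_tensor_square M ?u = incl_tensor_square M ?v \<longleftrightarrow> ?u = ?v"
      by (rule inj_on_eq_iff[OF incl_tensor_square_inj[OF M] u v])
    ultimately show ?thesis using m by simp
  qed
  have eq': "tensor_lift k M (\<lambda>x c. counit G c \<odot>\<^bsub>M\<^esub> x) (?r m)
      = tensor_lift k M (\<lambda>x c. counit D c \<odot>\<^bsub>M\<^esub> x) (coact M m)" if m: "m \<in> carrier M" for m
    using counit_incl_tensor[OF M linear_maps_closed[OF r m]] m by simp
  show ?thesis
    unfolding right_comodule_def right_comodule_axioms_def
    using M r ext r'_lin by (simp add: coact_update_tensor coact_update_simps eq eq' del: restrict_apply)
qed

text \<open>
  The two sides of the equation for a morphism over \<open>D\<close> lie in \<open>N \<otimes> D\<close>, and the embedding into \<open>N \<otimes> G\<close>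
  takes them to the two sides over \<open>G\<close>.
\<close>
lemma comodule_homs_iff:
  fixes M N :: "('k, 'm, 'a) comodule"
  assumes M: "right_comodule k D M" and N: "right_comodule k D N"
  shows "comodule_homs k G (M\<lparr>coact := restrict (\<lambda>m. incl_tensor M (coact M m)) (carrier M)\<rparr>)
      (N\<lparr>coact := restrict (\<lambda>m. incl_tensor N (coact N m)) (carrier N)\<rparr>) = comodule_homs k D M N"
proof -
  interpret M: right_comodule k D M by (rule M)
  interpret N: right_comodule k D N by (rule N)
  note M' = M.module_axioms and N' = N.module_axioms
  have eq: "tensor_map k N G f id (incl_tensor M (coact M m)) = incl_tensor N (coact N (f m))
      \<longleftrightarrow> tensor_map k N D f id (coact M m) = coact N (f m)"
    if f: "f \<in> linear_maps k M N" and m: "m \<in> carrier M" for f m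
  proof -
    note rm = linear_maps_closed[OF M.coact_linear m]
    have "tensor_map k N D f id (coact M m) \<in> carrier (tensor_product k N D)"
      by (rule linear_maps_closed[OF tensor_map_linear[OF M' D N' D f id_linear] rm])
    moreover have "coact N (f m) \<in> carrier (tensor_product k N D)"
      by (rule linear_maps_closed[OF N.coact_linear linear_maps_closed[OF f m]])
    ultimately show ?thesis
      using inj_on_eq_iff[OF incl_tensor_inj[OF N']]
      by (simp add: incl_tensor_tensor_map[OF M' N' f rm, symmetric])
  qed
  show ?thesis
    unfolding comodule_homs_def
    by (intro Collect_cong conj_cong ball_cong)
      (auto simp: coact_update_tensor coact_update_simps eq dest: linear_maps_closed)
qed

end

section \<open>Comodules over a subcoalgebra\<close>

lemma comult_update_tensor:
  fixes C :: "('k, 'a, 'x) coalgebra_scheme"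
  shows "tensor_product k N (C\<lparr>comult := d\<rparr>) = tensor_product k N C"
    and "tensor_product k (C\<lparr>comult := d\<rparr>) (C\<lparr>comult := d\<rparr>) = tensor_product k C C"
  by (rule tensor_product_cong; simp)+

text \<open>
  Used to see that forming tensor products with the restricted coalgebra only depends on the subspace,
  not on the comultiplication chosen for it.
\<close>
lemma restrict_coalgebra_update:
  "restrict_coalgebra k G C = (G\<lparr>carrier := C\<rparr>)\<lparr>comult := comult (restrict_coalgebra k G C)\<rparr>"
  by (simp add: restrict_coalgebra_def Let_def)

lemma tensor_product_restrict:
  "tensor_product k N (restrict_coalgebra k G C) = tensor_product k N (G\<lparr>carrier := C\<rparr>)"
  "tensor_product k (restrict_coalgebra k G C) (restrict_coalgebra k G C)
    = tensor_product k (G\<lparr>carrier := C\<rparr>) (G\<lparr>carrier := C\<rparr>)"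
  by (subst restrict_coalgebra_update, rule comult_update_tensor)
    (subst (1 2) restrict_coalgebra_update, rule comult_update_tensor)

lemma subcoalgebra_inclusion:
  assumes k: "field k" and G: "coalgebra k G" and C: "subcoalgebra k G C"
  shows "coalgebra_inclusion k (restrict_coalgebra k G C) G"
proof -
  interpret G: coalgebra k G by (rule G)
  have M: "module k G" by (rule G.module_axioms)
  let ?C = "G\<lparr>carrier := C\<rparr>" and ?D = "restrict_coalgebra k G C"
  have sub: "submodule C k G" and comult: "comult G ` C \<subseteq> sub_tensor k G G C C"
    using C by (auto simp: subcoalgebra_def)
  note C' = submodule_module[OF M sub]
  note i = linear_maps_inclusion[OF submodule_subset[OF sub], of k]
  note lin = tensor_map_linear[OF C' C' M M i i]
    and inj = tensor_map_inj_on[OF k C' C' M M i inj_on_id i inj_on_id]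
  have D_simps: "carrier ?D = C" "ring.add ?D = ring.add G" "ring.zero ?D = ring.zero G"
    "smult ?D = smult G" "counit ?D = counit G"
    by (simp_all add: restrict_coalgebra_def Let_def)
  have D: "module k ?D" by (rule module_cong[OF C']) (simp_all add: D_simps)
  have comult_D: "comult ?D c \<in> carrier (tensor_product k ?C ?C)
      \<and> tensor_map k G G id id (comult ?D c) = comult G c" if c: "c \<in> C" for c
  proof -
    obtain t where t: "t \<in> carrier (tensor_product k ?C ?C)" "tensor_map k G G id id t = comult G c"
      using comult c by (auto simp: sub_tensor_def)
    have "comult ?D c = (THE t. t \<in> carrier (tensor_product k ?C ?C)
        \<and> tensor_map k G G id id t = comult G c)"
      by (simp add: restrict_coalgebra_def Let_def)
    also have "\<dots> = t" using t inj by (intro the_equality) (auto dest: inj_onD)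
    finally show ?thesis using t by simp
  qed
  have iD: "id \<in> linear_maps k ?D G"
    using i by (simp add: linear_maps_def D_simps)
  have "comult ?D \<in> linear_maps k ?D (tensor_product k ?C ?C)"
  proof (rule linear_maps_factor[OF D tensor_product_module[OF C' C'] lin inj])
    show "(\<lambda>c. comult G (id c)) \<in> linear_maps k ?D (tensor_product k G G)"
      by (rule linear_maps_comp[OF iD G.comult_linear])
  qed (simp_all add: comult_D D_simps)
  then show ?thesis
    by (intro coalgebra_inclusion.intro k D G iD) (simp_all add: tensor_product_restrict(2) comult_D D_simps)
qed

text \<open>
  A comodule over \<open>C\<close> gives a module in \<open>Mod(G, C)\<close> by construction. For the converse, the coaction of a
  module in \<open>Mod(G, C)\<close> takes values in the image of \<open>M \<otimes> C\<close>, and its unique lift is a coaction of \<open>C\<close>.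
\<close>
theorem group_modules_in_subcoalgebra:
  fixes k :: "('k, 'r) ring_scheme" and G :: "('k, 'a, 'x) hopf_algebra_scheme"
  assumes k: "field k" and G: "coalgebra k G" and C: "subcoalgebra k G C"
  shows "(group_modules_in k G C :: ('k, 'm, 'a) comodule_category) = CoMod k G C"
proof -
  let ?D = "restrict_coalgebra k G C"
  interpret coalgebra_inclusion k ?D G by (rule subcoalgebra_inclusion[OF k G C])
  have extend: "extend_coaction k G M = M\<lparr>coact := restrict (\<lambda>m. incl_tensor M (coact M m)) (carrier M)\<rparr>"
    for M :: "('k, 'm, 'a) comodule"
    by (simp add: extend_coaction_def incl_tensor_def)
  have sub_tensor: "sub_tensor k M G (carrier M) C = incl_tensor M ` carrier (tensor_product k M ?D)"
    for M :: "('k, 'm, 'a) comodule"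
    by (simp add: sub_tensor_def incl_tensor_def tensor_product_restrict)
  have obj: "M \<in> objects (group_modules_in k G C)
      \<longleftrightarrow> (\<exists>N. right_comodule k ?D N \<and> M = extend_coaction k G N)" (is "?L \<longleftrightarrow> ?R")
    for M :: "('k, 'm, 'a) comodule"
  proof
    assume ?R
    then obtain N where N: "right_comodule k ?D N" "M = extend_coaction k G N" by blast
    interpret N: right_comodule k ?D N by (rule N(1))
    have "right_comodule k G M"
      using right_comodule_iff[OF N.module_axioms N.coact_linear N.coact_extensional] N extend by simp
    moreover have "coact M m \<in> sub_tensor k M G (carrier M) C" if "m \<in> carrier M" for m
    proof -
      have m: "m \<in> carrier N" using that N(2) by (simp add: extend)
      have "coact M m = incl_tensor M (coact N m)"
        using m by (simp add: N(2) extend incl_tensor_def coact_update_simps)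
      moreover have "coact N m \<in> carrier (tensor_product k M ?D)"
        using linear_maps_closed[OF N.coact_linear m] by (simp add: N(2) extend coact_update_tensor)
      ultimately show ?thesis unfolding sub_tensor by blast
    qed
    ultimately show ?L by (auto simp: objects_group_modules_in)
  next
    assume ?L
    then have M: "right_comodule k G M"
      and coact: "\<And>m. m \<in> carrier M \<Longrightarrow> coact M m \<in> incl_tensor M ` carrier (tensor_product k M ?D)"
      by (auto simp: objects_group_modules_in sub_tensor)
    interpret M: right_comodule k G M by (rule M)
    note M' = M.module_axioms
    \<comment> \<open>The lift is restricted to the carrier because coactions have to be extensional.\<close>
    define r where "r = restrict (\<lambda>m. inv_into (carrier (tensor_product k M ?D)) (incl_tensor M) (coact M m)) (carrier M)"
    have r: "r m \<in> carrier (tensor_product k M ?D)" "incl_tensor M (r m) = coact M m"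
      if "m \<in> carrier M" for m
      using that inv_into_into[OF coact[OF that]] f_inv_into_f[OF coact[OF that]] by (simp_all add: r_def)
    define N where "N = M\<lparr>coact := r\<rparr>"
    have N_simps: "carrier N = carrier M" "coact N = r" "N\<lparr>coact := q\<rparr> = M\<lparr>coact := q\<rparr>" for q
      by (simp_all add: N_def)
    have "r \<in> linear_maps k M (tensor_product k M ?D)"
      by (rule linear_maps_factor[OF M' MD[OF M'] incl_tensor_linear[OF M'] incl_tensor_inj[OF M']
            M.coact_linear r])
    then have lin: "coact N \<in> linear_maps k N (tensor_product k N ?D)"
      by (simp add: N_def coact_update_tensor coact_update_simps)
    have ext: "coact N \<in> extensional (carrier N)" by (simp add: N_simps r_def)
    have N': "module k N" using M' by (simp add: N_def coact_update_simps)
    have "restrict (\<lambda>m. incl_tensor N (coact N m)) (carrier N) = restrict (coact M) (carrier M)"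
      unfolding N_simps by (rule restrict_ext) (simp add: incl_tensor_def N_def coact_update_simps r(2)[unfolded incl_tensor_def])
    also have "\<dots> = coact M" by (rule extensional_restrict[OF M.coact_extensional])
    finally have "extend_coaction k G N = M" by (simp add: extend N_simps)
    then show ?R
      using right_comodule_iff[OF N' lin ext] M by (intro exI[of _ N]) (simp add: extend)
  qed
  have objects: "objects (group_modules_in k G C :: ('k, 'm, 'a) comodule_category) = objects (CoMod k G C)"
    by (auto simp: obj CoMod_def comodule_cat_def)
  have homs: "comodule_homs k G (extend_coaction k G M) (extend_coaction k G N) = comodule_homs k ?D M N"
    if "right_comodule k ?D M" "right_comodule k ?D N" for M N :: "('k, 'm, 'a) comodule"
    unfolding extend by (rule comodule_homs_iff[OF that])
  have "arrows (group_modules_in k G C :: ('k, 'm, 'a) comodule_category) =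
      {(M, f, N). M \<in> objects (group_modules_in k G C) \<and> N \<in> objects (group_modules_in k G C)
        \<and> f \<in> comodule_homs k G M N}"
    by (auto simp: group_modules_in_def comodule_cat_def)
  also have "\<dots> = arrows (CoMod k G C)"
    by (auto simp: obj CoMod_def comodule_cat_def homs image_iff) blast
  finally show ?thesis using objects by (intro comodule_category.equality) simp_all
qed

lemma group_modules_in_mono:
  assumes G: "coalgebra k G" and X: "submodule X k G" and Y: "submodule Y k G" and "X \<subseteq> Y"
  shows "is_subcategory (group_modules_in k G X :: ('k, 'm, 'a) comodule_category) (group_modules_in k G Y)"
proof -
  interpret G: coalgebra k G by (rule G)
  have "M \<in> objects (group_modules_in k G Y)"
    if M: "M \<in> objects (group_modules_in k G X)" for M :: "('k, 'm, 'a) comodule"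
  proof -
    interpret M: right_comodule k G M using M by (simp add: objects_group_modules_in)
    note carrM = module.carrier_is_submodule[OF M.module_axioms]
    show ?thesis
      using M sub_tensor_mono[OF M.module_axioms G.module_axioms carrM X carrM Y order_refl \<open>X \<subseteq> Y\<close>]
      by (auto simp: objects_group_modules_in)
  qed
  then show ?thesis by (auto simp: is_subcategory_def group_modules_in_def)
qed

theorem proposition3p2:
  fixes k :: "'k ring" and G :: "('k, 'a) hopf_algebra" and p :: nat
    and \<M> :: "('k, 'm, 'a) comodule set" and V :: "'a set"
  assumes "affine_group_scheme_of_finite_type k G"
    and "has_characteristic k p" and "p > 0"
    and "\<M> \<subseteq> objects (group_modules k G)"
    and V_def: "V = (LEAST Y. submodule Y k G \<and> (\<forall>M\<in>\<M>. M \<in> objects (group_modules_in k G Y)))"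
  shows "subcoalgebra k G (generated_subcoalgebra k G V)
    \<and> is_subcategory (group_modules_in k G V :: ('k, 'm, 'a) comodule_category)
        (CoMod k G (generated_subcoalgebra k G V))
    \<and> (\<forall>C. subcoalgebra k G C
          \<and> is_subcategory (group_modules_in k G V :: ('k, 'm, 'a) comodule_category) (CoMod k G C)
        \<longrightarrow> generated_subcoalgebra k G V \<subseteq> C)
    \<and> (group_modules_in k G (generated_subcoalgebra k G V) :: ('k, 'm, 'a) comodule_category)
        = CoMod k G (generated_subcoalgebra k G V)"
proof -
  interpret affine_group_scheme_of_finite_type k G by fact
  have k: "field k" by (rule field_axioms)
  have G: "coalgebra k G" by (rule coalgebra_axioms)
  have \<M>: "right_comodule k G M" if "M \<in> \<M>" for M
    using that assms(4) by (auto simp: comodule_cat_def)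
  have V: "submodule V k G"
    using \<M> by (rule least_coefficient_space_submodule[OF k G _ V_def])
  have V_mem: "M \<in> objects (group_modules_in k G V)" if "M \<in> \<M>" for M
    using \<M> that by (rule least_coefficient_space_mem[OF k G _ V_def])
  have V_least: "V \<subseteq> Y" if "submodule Y k G" "\<And>M. M \<in> \<M> \<Longrightarrow> M \<in> objects (group_modules_in k G Y)" for Y
    using \<M> that by (rule least_coefficient_space_least[OF k G _ V_def])
  let ?D = "generated_subcoalgebra k G V"
  note D = generated_subcoalgebra_subcoalgebra[OF k G submodule_subset[OF V]]
    and VD = generated_subcoalgebra_superset[OF k G submodule_subset[OF V]]
    and D_least = generated_subcoalgebra_least[OF k G submodule_subset[OF V]]
  have D_sub: "submodule ?D k G" using D by (simp add: subcoalgebra_def)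
  have eq: "(group_modules_in k G ?D :: ('k, 'm, 'a) comodule_category) = CoMod k G ?D"
    by (rule group_modules_in_subcoalgebra[OF k G D])
  have "?D \<subseteq> C" if C: "subcoalgebra k G C"
    and le: "is_subcategory (group_modules_in k G V :: ('k, 'm, 'a) comodule_category) (CoMod k G C)" for C
  proof (rule D_least[OF C V_least])
    show "submodule C k G" using C by (simp add: subcoalgebra_def)
    show "M \<in> objects (group_modules_in k G C)" if "M \<in> \<M>" for M
      using V_mem[OF that] le unfolding group_modules_in_subcoalgebra[OF k G C] is_subcategory_def by blast
  qed
  moreover have "is_subcategory (group_modules_in k G V :: ('k, 'm, 'a) comodule_category) (CoMod k G ?D)"
    unfolding eq[symmetric] by (rule group_modules_in_mono[OF G V D_sub VD])
  ultimately show ?thesis using D eq by blast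
qed

end
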